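(* Let $X=X(\Omega)$ be an almost perfect Banach ideal space, and let $A:X\to X$ be a completely continuous (i.e. compact) linear operator which is nonnegative with respect to the cone of nonnegative functions in $X$ and resolvent-regular. Then for the point spectrum of the operator $A\otimes A$, acting in the space $\widetilde{(X\otimes X)}_{L}$ (the $L$-complete tensor square of $X$), the following equality holds: $$\sigma_{p}(A\otimes A)\setminus\{0\}=(\sigma_{p}(A)\,\sigma_{p}(A))\setminus\{0\},$$ where $\sigma_p(A)\,\sigma_p(A)=\{\lambda\mu:\ \lambda,\mu\in\sigma_p(A)\}$.
   Context: $(\Omega,\mathfrak A,\mu)$ is a set with a $\sigma$-algebra and a complete, $\sigma$-finite, $\sigma$-additive measure; $S(\Omega)$ is the space of measurable, a.e. finite functions on $\Omega$ (functions equal a.e. are identified). A Banach ideal space $X=X(\Omega)$ is a Banach space of measurable functions on $\Omega$ (a linear subspace of $S(\Omega)$) such that $|x_1|\le|x_2|$, $x_1\in S(\Omega)$, $x_2\in X$ imply $x_1\in X$ and $\|x_1\|_X\le\|x_2\|_X$. It is assumed that $\operatorname{supp}X=\Omega$, i.e. $X$ contains a function which is positive almost everywhere on $\Omega$. $X$ is almost perfect if for every sequence $\{x_n\}\subset X$, $0\le x_n\uparrow x\in X$ implies $\|x_n\|\to\|x\|$. Spectra are understood over the complex numbers (complex scalars, or complexification). $\sigma(A)$ is the spectrum and $\sigma_p(A)$ the set of all eigenvalues of $A$. An operator on $X$ is nonnegative if it maps nonnegative functions to nonnegative functions. An operator is regular if it can be represented as $A_1-A_2$ with $A_1,A_2$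 nonnegative linear operators; for operators on the complex space, regular means that it has the form $(A_1-A_2)+i(A_3-A_4)$ with all $A_j$ nonnegative. $A$ is resolvent-regular if for every $\lambda\notin\sigma(A)$ the resolvent $(\lambda I-A)^{-1}$ is regular. The algebraic tensor square $X\otimes X$ is the set of all functions (called degenerate) on $\Omega\times\Omega$ of the form $x(t_1,t_2)=\sum_{i=1}^n x_1^i(t_1)x_2^i(t_2)$ with $x_1^i,x_2^i\in X$. Levin's norm on $X\otimes X$ is $$\|x\|_L=\inf\Bigl\{\|u\|_X:\ u\in X,\ u\ge\Bigl|\sum_i x_1^i\langle x_2^i,x^*\rangle\Bigr|\ \text{for all } x^*\in X^*,\ \|x^*\|_{X^*}\le1\Bigr\}.$$ $\widetilde{(X\otimes X)}_L$ is the completion of $X\otimes X$ with respect to $\|\cdot\|_L$; it is (up to isomorphism) a closed subspace of the mixed norm space $X_{21}$ with norm $\bigl\|\,\|x(t_1,t_2)\|_{(2)}\bigr\|_{(1)}$ (norm of $X$ applied first in $t_2$, then in $t_1$). The operator $A\otimes A$ is defined on degenerate functions by $(A\otimes A)\bigl(\sum_j x_1^j(t_1)x_2^j(t_2)\bigr)=\sum_j (Ax_1^j)(t_1)\,(Ax_2^j)(t_2)$ and extended by continuity to $\widetilde{(X\otimes X)}_L$ (for nonnegative $A$ this bounded extension exists). *)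

theory Defs
  imports "HOL-Analysis.Analysis" "HOL-Library.Complex_Order"
begin

section \<open>Complex Banach spaces\<close>

class complex_normed_vector = real_normed_vector +
  fixes scaleC :: "complex \<Rightarrow> 'a \<Rightarrow> 'a"  (infixr \<open>*\<^sub>C\<close> 75)
  assumes scaleC_add_right: "c *\<^sub>C (x + y) = c *\<^sub>C x + c *\<^sub>C y"
    and scaleC_add_left: "(c + d) *\<^sub>C x = c *\<^sub>C x + d *\<^sub>C x"
    and scaleC_scaleC: "c *\<^sub>C (d *\<^sub>C x) = (c * d) *\<^sub>C x"
    and scaleC_of_real: "complex_of_real r *\<^sub>C x = r *\<^sub>R x"
    and norm_scaleC: "norm (c *\<^sub>C x) = cmod c * norm x"

class complex_banach = complex_normed_vector + complete_space

subclass (in complex_banach) banach ..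

instantiation complex :: complex_banach
begin

definition scaleC_complex :: "complex \<Rightarrow> complex \<Rightarrow> complex" where
  "scaleC_complex c x = c * x"

instance
  by standard
    (simp_all add: scaleC_complex_def algebra_simps norm_mult scaleR_conv_of_real)

end

lemma vector_space_scaleC:
  "vector_space (scaleC :: complex \<Rightarrow> 'v \<Rightarrow> 'v::complex_normed_vector)"
proof
  show "1 *\<^sub>C x = x" for x :: 'v
    using scaleC_of_real[of 1 x] by simp
qed (simp_all add: scaleC_add_right scaleC_add_left scaleC_scaleC)

abbreviation clinear :: "('v::complex_normed_vector \<Rightarrow> 'w::complex_normed_vector) \<Rightarrow> bool" where
  "clinear \<equiv> Vector_Spaces.linear scaleC scaleC"

definition bounded_clinear :: "('v::complex_normed_vector \<Rightarrow> 'w::complex_normed_vector) \<Rightarrow> bool" where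
  "bounded_clinear f \<longleftrightarrow> clinear f \<and> bounded_linear f"

definition compact_operator :: "('v::complex_normed_vector \<Rightarrow> 'w::complex_normed_vector) \<Rightarrow> bool" where
  "compact_operator A \<longleftrightarrow> clinear A \<and> (\<forall>B. bounded B \<longrightarrow> compact (closure (A ` B)))"

definition point_spectrum :: "('v::complex_normed_vector \<Rightarrow> 'v) \<Rightarrow> complex set" where
  "point_spectrum A = {\<alpha>. \<exists>x. x \<noteq> 0 \<and> A x = \<alpha> *\<^sub>C x}"

definition resolvent :: "('v::complex_normed_vector \<Rightarrow> 'v) \<Rightarrow> complex \<Rightarrow> 'v \<Rightarrow> 'v" where
  "resolvent A \<alpha> = inv (\<lambda>x. \<alpha> *\<^sub>C x - A x)"

definition spectrum :: "('v::complex_normed_vector \<Rightarrow> 'v) \<Rightarrow> complex set" where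
  "spectrum A = {\<alpha>. \<not> (bij (\<lambda>x. \<alpha> *\<^sub>C x - A x) \<and> bounded_clinear (resolvent A \<alpha>))}"

section \<open>Banach ideal spaces\<close>

text \<open>
  Elements of a Banach ideal space are classes of measurable functions modulo equality almost
  everywhere.  They form an abstract Banach space \<open>'x\<close>, and \<open>rep\<close> selects a function from each
  class; so \<open>rep\<close> is linear and injective only up to null sets.  The order on \<^typ>\<open>complex\<close> is the
  one of \<open>Complex_Order\<close>: \<open>a \<le> b\<close> means that \<open>b - a\<close> is a nonnegative real.
\<close>

locale banach_ideal_space = sigma_finite_measure M + complete_measure M
  for M :: "'a measure" +
  fixes rep :: "'x::complex_banach \<Rightarrow> 'a \<Rightarrow> complex"
  assumes rep_measurable: "rep x \<in> borel_measurable M"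
    and rep_add: "AE s in M. rep (x + y) s = rep x s + rep y s"
    and rep_scaleC: "AE s in M. rep (c *\<^sub>C x) s = c * rep x s"
    and rep_inject: "AE s in M. rep x s = rep y s \<Longrightarrow> x = y"
    and ideal: "f \<in> borel_measurable M \<Longrightarrow> AE s in M. cmod (f s) \<le> cmod (rep x s) \<Longrightarrow>
      \<exists>y. (AE s in M. rep y s = f s) \<and> norm y \<le> norm x"
    and full_support: "\<exists>u. AE s in M. 0 < rep u s"

definition almost_perfect :: "'a measure \<Rightarrow> ('x::complex_banach \<Rightarrow> 'a \<Rightarrow> complex) \<Rightarrow> bool" where
  "almost_perfect M rep \<longleftrightarrow>
    (\<forall>f x. (AE s in M. (\<forall>n. 0 \<le> rep (f n) s \<and> rep (f n) s \<le> rep (f (Suc n)) s) \<and>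
                       (\<lambda>n. rep (f n) s) \<longlonglongrightarrow> rep x s) \<longrightarrow>
           (\<lambda>n::nat. norm (f n)) \<longlonglongrightarrow> norm x)"

definition nonneg_operator ::
  "'a measure \<Rightarrow> ('x::complex_banach \<Rightarrow> 'a \<Rightarrow> complex) \<Rightarrow> ('x \<Rightarrow> 'x) \<Rightarrow> bool" where
  "nonneg_operator M rep A \<longleftrightarrow>
    (\<forall>x. (AE s in M. 0 \<le> rep x s) \<longrightarrow> (AE s in M. 0 \<le> rep (A x) s))"

definition regular_operator ::
  "'a measure \<Rightarrow> ('x::complex_banach \<Rightarrow> 'a \<Rightarrow> complex) \<Rightarrow> ('x \<Rightarrow> 'x) \<Rightarrow> bool" where
  "regular_operator M rep T \<longleftrightarrow>
    (\<exists>A\<^sub>1 A\<^sub>2 A\<^sub>3 A\<^sub>4. (\<forall>A\<in>{A\<^sub>1, A\<^sub>2, A\<^sub>3, A\<^sub>4}. clinear A \<and> nonneg_operator M rep A) \<and>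
      (\<forall>x. T x = (A\<^sub>1 x - A\<^sub>2 x) + \<i> *\<^sub>C (A\<^sub>3 x - A\<^sub>4 x)))"

definition resolvent_regular ::
  "'a measure \<Rightarrow> ('x::complex_banach \<Rightarrow> 'a \<Rightarrow> complex) \<Rightarrow> ('x \<Rightarrow> 'x) \<Rightarrow> bool" where
  "resolvent_regular M rep A \<longleftrightarrow>
    (\<forall>\<alpha>. \<alpha> \<notin> spectrum A \<longrightarrow> regular_operator M rep (resolvent A \<alpha>))"

section \<open>The L-complete tensor square\<close>

definition degenerate ::
  "('x \<Rightarrow> 'a \<Rightarrow> complex) \<Rightarrow> nat \<Rightarrow> (nat \<Rightarrow> 'x) \<Rightarrow> (nat \<Rightarrow> 'x) \<Rightarrow> 'a \<times> 'a \<Rightarrow> complex" where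
  "degenerate rep n x y = (\<lambda>(t\<^sub>1, t\<^sub>2). \<Sum>i<n. rep (x i) t\<^sub>1 * rep (y i) t\<^sub>2)"

definition tensor_square ::
  "'a measure \<Rightarrow> ('x \<Rightarrow> 'a \<Rightarrow> complex) \<Rightarrow> ('a \<times> 'a \<Rightarrow> complex) set" where
  "tensor_square M rep =
    {z. \<exists>n x y. AE p in M \<Otimes>\<^sub>M M. z p = degenerate rep n x y p}"

text \<open>
  The functions \<open>\<Sum>i<n. rep (x i) s * \<phi> (y i)\<close> of \<open>s\<close> below depend, up to null sets, only on the
  class of \<open>z\<close> and not on its representation as a degenerate function.
\<close>

definition levin_norm ::
  "'a measure \<Rightarrow> ('x::complex_banach \<Rightarrow> 'a \<Rightarrow> complex) \<Rightarrow> ('a \<times> 'a \<Rightarrow> complex) \<Rightarrow> real" where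
  "levin_norm M rep z = Inf {norm u | u.
     \<exists>n x y. (AE p in M \<Otimes>\<^sub>M M. z p = degenerate rep n x y p) \<and>
       (\<forall>\<phi> :: 'x \<Rightarrow> complex. bounded_clinear \<phi> \<longrightarrow> onorm \<phi> \<le> 1 \<longrightarrow>
         (AE s in M. complex_of_real (cmod (\<Sum>i<n. rep (x i) s * \<phi> (y i))) \<le> rep u s))}"

text \<open>
  A completion is a complete space \<open>'c\<close> with a linear isometry \<open>\<iota>\<close> of the tensor square (modulo
  equality almost everywhere) onto a dense subspace; it is unique up to isometric isomorphism.
\<close>

definition levin_completion ::
  "'a measure \<Rightarrow> ('x::complex_banach \<Rightarrow> 'a \<Rightarrow> complex) \<Rightarrow>
    (('a \<times> 'a \<Rightarrow> complex) \<Rightarrow> 'c::complex_banach) \<Rightarrow> bool" where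
  "levin_completion M rep \<iota> \<longleftrightarrow>
    (\<forall>z\<in>tensor_square M rep. \<forall>w\<in>tensor_square M rep. \<iota> (\<lambda>p. z p + w p) = \<iota> z + \<iota> w) \<and>
    (\<forall>c. \<forall>z\<in>tensor_square M rep. \<iota> (\<lambda>p. c * z p) = c *\<^sub>C \<iota> z) \<and>
    (\<forall>z\<in>tensor_square M rep. norm (\<iota> z) = levin_norm M rep z) \<and>
    closure (\<iota> ` tensor_square M rep) = UNIV"

definition tensor_square_operator ::
  "('x::complex_banach \<Rightarrow> 'a \<Rightarrow> complex) \<Rightarrow> (('a \<times> 'a \<Rightarrow> complex) \<Rightarrow> 'c::complex_banach) \<Rightarrow>
    ('x \<Rightarrow> 'x) \<Rightarrow> 'c \<Rightarrow> 'c" where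
  "tensor_square_operator rep \<iota> A = (THE T. bounded_clinear T \<and>
     (\<forall>n x y. T (\<iota> (degenerate rep n x y)) = \<iota> (degenerate rep n (A \<circ> x) (A \<circ> y))))"

end

theory Submission
  imports Defs "HOL-Computational_Algebra.Fundamental_Theorem_Algebra"
begin

text \<open>
  An element \<open>z\<close> of the completed tensor square is determined by its slices \<open>(id \<otimes> \<phi>) z\<close>, \<open>\<phi>\<close> in the
  dual: approximating \<open>z\<close> by degenerate functions, the Levin majorants of the successive differences
  add up to a majorant of all slices at once.  Hence \<open>z\<close> may be replaced by the bilinear form
  \<open>b (\<psi>, \<phi>) = \<psi> ((id \<otimes> \<phi>) z)\<close> on the dual, and \<open>(A \<otimes> A) z = \<kappa> z\<close> becomes
  \<open>b (\<psi> \<circ> A, \<phi> \<circ> A) = \<kappa> b (\<psi>, \<phi>)\<close>.  By Schauder's theorem \<open>\<psi> \<mapsto> \<psi> \<circ> A\<close> maps the unit ball to a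
  totally bounded set, so for \<open>\<kappa> \<noteq> 0\<close> these forms make up a finite-dimensional space.  It is invariant
  under \<open>b \<mapsto> b (\<psi> \<circ> A, \<phi>)\<close>, which therefore has an eigenvector there, with eigenvalue \<open>\<alpha>\<close> say; it
  satisfies \<open>b (\<psi>, \<phi> \<circ> A) = (\<kappa> / \<alpha>) b (\<psi>, \<phi>)\<close>, and its two partial forms yield eigenvectors of \<open>A\<close>
  for \<open>\<alpha>\<close> and \<open>\<kappa> / \<alpha>\<close>.
\<close>

section \<open>Complex linear maps and duality\<close>

text \<open>The obstacle is the passage from the completion to forms. The Levin norm dominates the
  injective norm, but domination alone does not make the induced map on the completion injective: a
  sequence that is Cauchy for the larger norm may tend to 0 in the smaller one and still have a
  nonzero limit. The order rescues injectivity. Majorization survives norm limits, so if all slices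
  of z vanish and d approximates z, then a small majorant of the slices of z - d also majorizes
  those of d, and d itself is small. Nonnegativity of A enters where A \<otimes> A has to be
  continuous for the Levin norm: such an operator carries majorants to majorants up to a constant.
  After that only the duality of X and the compactness of A are left. The Levin norm treats the two
  variables differently, with majorants only for slices that are functions of the first one; the
  slices in the other variable are controlled through duality.\<close>

lemma clinear_iff:
  "clinear f \<longleftrightarrow> (\<forall>x y. f (x + y) = f x + f y) \<and> (\<forall>c x. f (c *\<^sub>C x) = c *\<^sub>C f x)"
  unfolding Vector_Spaces.linear_iff by (simp add: vector_space_scaleC)

lemma
  assumes "clinear f"
  shows clinear_add: "f (x + y) = f x + f y"
    and clinear_scaleC: "f (c *\<^sub>C x) = c *\<^sub>C f x"
    and clinear_scaleR: "f (r *\<^sub>R x) = r *\<^sub>R f x"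
    and clinear_0: "f 0 = 0"
    and clinear_diff: "f (x - y) = f x - f y"
    and clinear_sum: "f (sum h I) = (\<Sum>i\<in>I. f (h i))"
proof -
  show a: "f (x + y) = f x + f y" for x y
    using assms by (simp add: clinear_iff)
  show "f (c *\<^sub>C x) = c *\<^sub>C f x"
    using assms by (simp add: clinear_iff)
  show "f (r *\<^sub>R x) = r *\<^sub>R f x"
    using assms unfolding scaleC_of_real[symmetric] by (simp add: clinear_iff)
  show z: "f 0 = 0"
    using a[of 0 0] by simp
  show "f (x - y) = f x - f y"
    using a[of "x - y" y] by simp
  show "f (sum h I) = (\<Sum>i\<in>I. f (h i))"
    by (induction I rule: infinite_finite_induct) (simp_all add: z a)
qed

lemma scaleC_1 [simp]: "1 *\<^sub>C x = x"
  using scaleC_of_real[of 1 x] by simp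

lemma scaleC_zero_left [simp]: "0 *\<^sub>C x = 0"
  using scaleC_of_real[of 0 x] by simp

lemma clinear_scaleC_self: "clinear ((*\<^sub>C) c)"
  by (simp add: clinear_iff scaleC_add_right scaleC_scaleC mult.commute)

lemmas scaleC_zero_right [simp] = clinear_0[OF clinear_scaleC_self]
lemmas scaleC_sum_right = clinear_sum[OF clinear_scaleC_self]

lemma scaleC_minus_1: "(- 1) *\<^sub>C x = - x"
  using scaleC_of_real[of "-1" x] by simp

lemma bounded_clinearI:
  assumes "\<And>x y. f (x + y) = f x + f y" and "\<And>c x. f (c *\<^sub>C x) = c *\<^sub>C f x"
    and "\<And>x. norm (f x) \<le> K * norm x"
  shows "bounded_clinear f"
proof -
  have cl: "clinear f"
    using assms by (simp add: clinear_iff)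
  have "bounded_linear f"
    by (rule bounded_linear_intro[where K = K])
      (auto simp: assms(1) clinear_scaleR[OF cl] mult.commute[of _ K] intro: assms(3))
  with cl show ?thesis
    by (simp add: bounded_clinear_def)
qed

lemma bounded_clinear_compose:
  "bounded_clinear f \<Longrightarrow> bounded_clinear g \<Longrightarrow> bounded_clinear (\<lambda>x. f (g x))"
  unfolding bounded_clinear_def by (auto simp: clinear_iff intro: bounded_linear_compose)

lemma bounded_clinear_scaleC: "bounded_clinear ((*\<^sub>C) c)"
  by (rule bounded_clinearI[where K = "cmod c"])
    (simp_all add: scaleC_add_right scaleC_scaleC norm_scaleC mult.commute)

text \<open>The closed ball of radius c in the dual. With the pointwise bound in place of
  \<open>onorm\<close>, membership already contains continuity, and composition or rescaling only
  changes the radius.\<close>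

definition dual_ball :: "real \<Rightarrow> ('v::complex_normed_vector \<Rightarrow> complex) set" where
  "dual_ball c = {\<phi>. clinear \<phi> \<and> (\<forall>x. cmod (\<phi> x) \<le> c * norm x)}"

lemma dual_ball_bounded_clinear: "\<phi> \<in> dual_ball c \<Longrightarrow> bounded_clinear \<phi>"
  unfolding dual_ball_def by (auto intro!: bounded_clinearI[where K = c] simp: clinear_iff)

lemma bounded_clinear_dual_ball:
  assumes "bounded_clinear \<phi>"
  obtains c where "c > 0" "\<phi> \<in> dual_ball c"
proof -
  from assms obtain c where "c > 0" "\<And>x. norm (\<phi> x) \<le> norm x * c"
    unfolding bounded_clinear_def using bounded_linear.pos_bounded by blast
  then show thesis
    using assms that[of c] by (auto simp: dual_ball_def bounded_clinear_def mult.commute)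
qed

lemma dual_ball_1_iff: "\<phi> \<in> dual_ball 1 \<longleftrightarrow> bounded_clinear \<phi> \<and> onorm \<phi> \<le> 1"
proof
  assume p: "\<phi> \<in> dual_ball 1"
  then have "onorm \<phi> \<le> 1"
    by (auto simp: dual_ball_def intro: onorm_bound)
  with dual_ball_bounded_clinear[OF p] show "bounded_clinear \<phi> \<and> onorm \<phi> \<le> 1" ..
next
  assume *: "bounded_clinear \<phi> \<and> onorm \<phi> \<le> 1"
  then have "norm (\<phi> x) \<le> 1 * norm x" for x
    using onorm[of \<phi> x] mult_right_mono[of "onorm \<phi>" 1 "norm x"]
    by (simp add: bounded_clinear_def)
  with * show "\<phi> \<in> dual_ball 1"
    by (simp add: dual_ball_def bounded_clinear_def)
qed

lemma dual_ball_scale: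
  assumes "\<phi> \<in> dual_ball c"
  shows "(\<lambda>x. k * \<phi> x) \<in> dual_ball (cmod k * c)"
  using assms mult_left_mono[of "cmod (\<phi> x)" "c * norm x" "cmod k" for x]
  by (auto simp: dual_ball_def clinear_iff norm_mult scaleC_complex_def algebra_simps)

lemma dual_ball_normalize:
  assumes "\<phi> \<in> dual_ball c" "c > 0"
  shows "(\<lambda>x. complex_of_real (1 / c) * \<phi> x) \<in> dual_ball 1"
  using dual_ball_scale[OF assms(1), of "complex_of_real (1 / c)"] assms(2)
  by (simp add: norm_divide)

section \<open>Hahn--Banach\<close>

definition sublinear :: "('v::real_vector \<Rightarrow> real) \<Rightarrow> bool" where
  "sublinear p \<longleftrightarrow> (\<forall>x y. p (x + y) \<le> p x + p y) \<and> (\<forall>r\<ge>0. \<forall>x. p (r *\<^sub>R x) = r * p x)"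

lemma sublinear_lower: "sublinear p \<Longrightarrow> - p (- x) \<le> p x"
proof -
  assume p: "sublinear p"
  have "p (0 *\<^sub>R x) = 0 * p x"
    using p unfolding sublinear_def by blast
  then have "0 \<le> p x + p (- x)"
    using p unfolding sublinear_def by (metis add.right_inverse mult_zero_left scaleR_zero_left)
  then show ?thesis by simp
qed

text \<open>Among the sublinear functionals below p with value at most - p y at - y, this q is the
  largest. It serves twice: if p is minimal, q = p makes p odd; if p is the norm, every linear
  functional below q attains the norm at y.\<close>

lemma sublinear_shift:
  fixes y :: "'v::real_vector"
  assumes p: "sublinear p"
  defines "q \<equiv> \<lambda>x. INF t\<in>{0..}. p (x + t *\<^sub>R y) - t * p y"
  shows "sublinear q" "q x \<le> p x" "q (- y) \<le> - p y"
proof -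
  have sub: "p (x + z) \<le> p x + p z" and hom: "r \<ge> 0 \<Longrightarrow> p (r *\<^sub>R x) = r * p x" for r x z
    using p by (auto simp: sublinear_def)
  have lb: "- p (- x) \<le> p (x + t *\<^sub>R y) - t * p y" if "t \<ge> 0" for t x
    using sub[of "x + t *\<^sub>R y" "- x"] hom[OF that, of y] by simp
  have bdd: "bdd_below ((\<lambda>t. p (x + t *\<^sub>R y) - t * p y) ` {0..})" for x
    using lb by (intro bdd_belowI2[where m = "- p (- x)"]) auto
  have q_le: "q x \<le> p (x + t *\<^sub>R y) - t * p y" if "t \<ge> 0" for t x
    unfolding q_def using that by (intro cINF_lower[OF bdd]) auto
  have le_q: "c \<le> q x" if "\<And>t. t \<ge> 0 \<Longrightarrow> c \<le> p (x + t *\<^sub>R y) - t * p y" for c x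
    unfolding q_def using that by (intro cINF_greatest) auto
  show "q x \<le> p x" for x
    using q_le[of 0 x] by simp
  have p0: "p 0 = 0"
    using hom[of 0 0] by simp
  show "q (- y) \<le> - p y"
    using q_le[of 1 "- y"] p0 by simp
  have "q (x + z) \<le> q x + q z" for x z
  proof -
    have "q (x + z) - q z \<le> p (x + t *\<^sub>R y) - t * p y" if t: "t \<ge> 0" for t
    proof -
      \<comment> \<open>Subadditivity pairs the parameters t and s in the parameter t + s; the two
        infima are then taken one after the other, first over s, then over t.\<close>
      have "q (x + z) - (p (x + t *\<^sub>R y) - t * p y) \<le> p (z + s *\<^sub>R y) - s * p y" if s: "s \<ge> 0" for s
        using q_le[of "t + s" "x + z"] sub[of "x + t *\<^sub>R y" "z + s *\<^sub>R y"] s t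
        by (simp add: algebra_simps)
      from le_q[OF this] show ?thesis by simp
    qed
    from le_q[OF this] show ?thesis by simp
  qed
  moreover have "q (r *\<^sub>R x) = r * q x" if "r \<ge> 0" for r x
  proof (cases "r = 0")
    case True
    have "q 0 = 0"
    proof (rule order.antisym)
      show "q 0 \<le> 0" using q_le[of 0 0] p0 by simp
      show "0 \<le> q 0" by (rule le_q) (simp add: hom)
    qed
    with True show ?thesis by simp
  next
    case False
    \<comment> \<open>Rescaling the parameter to t / r yields one inequality; applying it to 1 / r
      and the vector r x yields the converse.\<close>
    have ge: "r * q x \<le> q (r *\<^sub>R x)" if r: "r > 0" for r x
    proof (rule le_q)
      fix t :: real assume "t \<ge> 0"
      then have "r * q x \<le> r * (p (x + (t / r) *\<^sub>R y) - (t / r) * p y)"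
        using r by (intro mult_left_mono q_le) auto
      also have "\<dots> = p (r *\<^sub>R (x + (t / r) *\<^sub>R y)) - t * p y"
        using r by (subst hom) (simp_all add: right_diff_distrib)
      finally show "r * q x \<le> p (r *\<^sub>R x + t *\<^sub>R y) - t * p y"
        using r by (simp add: scaleR_add_right)
    qed
    from that False have r: "r > 0" by simp
    have "(1 / r) * q (r *\<^sub>R x) \<le> q x"
      using ge[of "1 / r" "r *\<^sub>R x"] r by simp
    then have "q (r *\<^sub>R x) \<le> r * q x"
      using r by (simp add: pos_divide_le_eq mult.commute)
    with ge[OF r, of x] show ?thesis by simp
  qed
  ultimately show "sublinear q"
    by (simp add: sublinear_def)
qed

text \<open>A minimal element among the sublinear functionals below \<open>p\<close> is linear, because shifting it
  along any vector cannot make it smaller.\<close>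

lemma sublinear_dominates_linear:
  assumes p: "sublinear p"
  obtains f where "linear f" "\<And>x. f x \<le> p x"
proof -
  define Q where "Q = {q. sublinear q \<and> q \<le> p}"
  have Q: "sublinear q" "q x \<le> p x" if "q \<in> Q" for q x
    using that by (auto simp: Q_def le_fun_def)
  \<comment> \<open>Zorn's lemma is applied to the reversed order, so its maximal elements are the
    minimal functionals, and a chain is bounded by its pointwise infimum.\<close>
  have "\<exists>m\<in>Q. \<forall>a\<in>Q. m \<ge> a \<longrightarrow> a = m"
  proof (rule predicate_Zorn)
    show "partial_order_on Q (relation_of (\<ge>) Q)"
      by (intro partial_order_on_relation_ofI) auto
    fix C assume C: "C \<in> Chains (relation_of (\<ge>) Q)"
    then have CQ: "C \<subseteq> Q" and ch: "q \<in> C \<Longrightarrow> r \<in> C \<Longrightarrow> q \<le> r \<or> r \<le> q" for q r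
      by (auto simp: Chains_def relation_of_def)
    show "\<exists>u\<in>Q. \<forall>a\<in>C. a \<ge> u"
    proof (cases "C = {}")
      case True
      then show ?thesis using p by (auto simp: Q_def)
    next
      case ne: False
      define u where "u = (\<lambda>x. INF q\<in>C. q x)"
      have "- p (- x) \<le> q x" if "q \<in> C" for q x
        using Q[of q] that CQ sublinear_lower[of q x] by (meson le_minus_iff minus_le_iff order_trans subsetD)
      then have bdd: "bdd_below ((\<lambda>q. q x) ` C)" for x
        by (intro bdd_belowI2)
      have u_le: "u x \<le> q x" if "q \<in> C" for q x
        unfolding u_def using that by (intro cINF_lower[OF bdd])
      have le_u: "c \<le> u x" if "\<And>q. q \<in> C \<Longrightarrow> c \<le> q x" for c x
        unfolding u_def using that ne by (intro cINF_greatest)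
      have "u (x + y) \<le> u x + u y" for x y
      proof -
        have "u (x + y) - u y \<le> q x" if q: "q \<in> C" for q
        proof -
          have "u (x + y) - q x \<le> r y" if r: "r \<in> C" for r
          proof -
            \<comment> \<open>Here the chain property is essential: the smaller of q and r bounds
              both terms at once, which makes the infimum subadditive.\<close>
            obtain m where m: "m \<in> C" "m \<le> q" "m \<le> r"
              using ch[OF q r] q r by auto
            have "u (x + y) \<le> m x + m y"
              using u_le[OF m(1), of "x + y"] Q(1)[of m] CQ m(1) unfolding sublinear_def
              by (meson order_trans subsetD)
            also have "\<dots> \<le> q x + r y"
              using m by (intro add_mono) (auto simp: le_fun_def)
            finally show ?thesis by simp
          qed
          then have "u (x + y) - q x \<le> u y" by (rule le_u)
          then show ?thesis by simp
        qed
        then have "u (x + y) - u y \<le> u x" by (rule le_u)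
        then show ?thesis by simp
      qed
      moreover have "u (r *\<^sub>R x) = r * u x" if r: "r \<ge> 0" for r x
      proof -
        have hom: "q (r *\<^sub>R x) = r * q x" if "q \<in> C" "r \<ge> 0" for q r x
          using Q(1)[of q] CQ that by (auto simp: sublinear_def)
        have ge: "r * u x \<le> u (r *\<^sub>R x)" if "r \<ge> 0" for r x
          using that by (intro le_u) (simp add: hom u_le mult_left_mono)
        show ?thesis
        proof (cases "r = 0")
          case True
          obtain q where "q \<in> C" using ne by blast
          then have "u 0 \<le> 0" using u_le[of q 0] hom[of q 0 0] by simp
          with ge[of 0 0] True show ?thesis by simp
        next
          case False
          with r have pos: "r > 0" by simp
          then have "(1 / r) * u (r *\<^sub>R x) \<le> u x"
            using ge[of "1 / r" "r *\<^sub>R x"] by simp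
          then have "u (r *\<^sub>R x) \<le> r * u x"
            using pos by (simp add: pos_divide_le_eq mult.commute)
          with ge[OF r, of x] show ?thesis by simp
        qed
      qed
      ultimately have "sublinear u" by (simp add: sublinear_def)
      moreover have "u \<le> p"
      proof (rule le_funI)
        fix x
        obtain q where "q \<in> C" using ne by blast
        then show "u x \<le> p x"
          using u_le[of q x] Q(2)[of q x] CQ by force
      qed
      ultimately show ?thesis
        using u_le by (auto simp: Q_def le_fun_def)
    qed
  qed
  then obtain m where m: "m \<in> Q" and min: "\<And>a. a \<in> Q \<Longrightarrow> a \<le> m \<Longrightarrow> a = m" by blast
  have sub: "m (x + z) \<le> m x + m z" and hom: "r \<ge> 0 \<Longrightarrow> m (r *\<^sub>R x) = r * m x" for r x z
    using Q(1)[OF m] by (auto simp: sublinear_def)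
  have neg: "m (- y) = - m y" for y
  proof -
    let ?q = "\<lambda>x. INF t\<in>{0..}. m (x + t *\<^sub>R y) - t * m y"
    note q = sublinear_shift[OF Q(1)[OF m], where y = y]
    have "?q \<in> Q"
      using q(1,2) Q(2)[OF m] by (auto simp: Q_def le_fun_def intro: order_trans)
    then have "?q = m"
      using q(2) by (intro min) (auto simp: le_fun_def)
    from q(3)[unfolded fun_cong[OF this]] have "m (- y) \<le> - m y" .
    with sublinear_lower[OF Q(1)[OF m], of y] show ?thesis by simp
  qed
  have "linear m"
  proof
    show "m (x + y) = m x + m y" for x y
      using sub[of x y] sub[of "- x" "- y"] neg[of x] neg[of y] neg[of "x + y"] by simp
    show "m (r *\<^sub>R x) = r *\<^sub>R m x" for r x
      using hom[of r x] hom[of "- r" x] neg[of "r *\<^sub>R x"] by (cases "r \<ge> 0") auto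
  qed
  with Q(2)[OF m] that show thesis by blast
qed

text \<open>A real linear f below the norm shifted along x satisfies f (- x) \<le> - norm x, hence f
  x \<ge> norm x. The complex functional is the usual f y - \<i> f (\<i> y), whose real part is
  f.\<close>

lemma norming_functional:
  fixes x :: "'v::complex_normed_vector"
  obtains \<phi> where "\<phi> \<in> dual_ball 1" "\<phi> x = norm x"
proof -
  have n: "sublinear (norm :: 'v \<Rightarrow> real)"
    by (simp add: sublinear_def norm_triangle_ineq)
  note q = sublinear_shift[OF n, where y = x]
  obtain f where f: "linear f" "\<And>y. f y \<le> (INF t\<in>{0..}. norm (y + t *\<^sub>R x) - t * norm x)"
    using sublinear_dominates_linear[OF q(1)] by blast
  have le: "f y \<le> norm y" for y
    using f(2)[of y] q(2)[of y] by simp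
  have fx: "norm x \<le> f x"
    using f(2)[of "- x"] q(3) linear_neg[OF f(1), of x] by simp
  define \<phi> where "\<phi> y = Complex (f y) (- f (\<i> *\<^sub>C y))" for y
  have cR: "c *\<^sub>C y = Re c *\<^sub>R y + Im c *\<^sub>R (\<i> *\<^sub>C y)" for c and y :: 'v
  proof -
    have "c *\<^sub>C y = (complex_of_real (Re c) + complex_of_real (Im c) * \<i>) *\<^sub>C y"
      by (metis complex_eq mult.commute)
    then show ?thesis
      by (simp only: scaleC_add_left scaleC_scaleC[symmetric] scaleC_of_real)
  qed
  have ii: "\<i> *\<^sub>C \<i> *\<^sub>C y = - y" for y :: 'v
    by (simp add: scaleC_scaleC scaleC_minus_1)
  have iR: "\<i> *\<^sub>C (r *\<^sub>R y) = r *\<^sub>R (\<i> *\<^sub>C y)" for r and y :: 'v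
    by (rule clinear_scaleR[OF clinear_scaleC_self])
  note lin = linear_add[OF f(1)] linear_scale[OF f(1)] linear_neg[OF f(1)]
  have icR: "\<i> *\<^sub>C c *\<^sub>C y = Re c *\<^sub>R (\<i> *\<^sub>C y) - Im c *\<^sub>R y" for c and y :: 'v
    by (subst cR[of c]) (simp add: scaleC_add_right iR ii)
  have cl: "clinear \<phi>"
    unfolding clinear_iff
  proof (intro conjI allI)
    show "\<phi> (y + z) = \<phi> y + \<phi> z" for y z
      by (simp add: \<phi>_def complex_eq_iff scaleC_add_right lin)
    show "\<phi> (c *\<^sub>C y) = c *\<^sub>C \<phi> y" for c y
      unfolding \<phi>_def icR by (subst cR[of c])
        (simp add: complex_eq_iff scaleC_complex_def lin linear_diff[OF f(1)])
  qed
  have bd: "cmod (\<phi> y) \<le> norm y" for y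
  proof (cases "\<phi> y = 0")
    case False
    \<comment> \<open>The factor c rotates \<phi> y onto the positive real axis, where its modulus
      is its real part and the bound for f applies.\<close>
    define c where "c = cnj (\<phi> y) / cmod (\<phi> y)"
    have c: "cmod c = 1" "c * \<phi> y = cmod (\<phi> y)"
      using False complex_norm_square[of "\<phi> y"]
      by (simp_all add: c_def norm_divide power2_eq_square field_simps)
    have "cmod (\<phi> y) = Re (\<phi> (c *\<^sub>C y))"
      by (simp add: clinear_scaleC[OF cl] scaleC_complex_def c)
    also have "\<dots> \<le> norm y"
      using le[of "c *\<^sub>C y"] by (simp add: \<phi>_def norm_scaleC c)
    finally show ?thesis .
  qed simp
  have "Re (\<phi> x) = norm x"
    using fx le[of x] by (simp add: \<phi>_def)
  moreover from this have "Im (\<phi> x) = 0"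
    using bd[of x] cmod_power2[of "\<phi> x"]
    by (smt (verit) norm_ge_zero power2_less_imp_less power_mono zero_eq_power2 zero_le_power2)
  ultimately have "\<phi> x = norm x"
    by (simp add: complex_eq_iff)
  moreover have "\<phi> \<in> dual_ball 1"
    using cl bd by (simp add: dual_ball_def)
  ultimately show thesis using that by blast
qed

lemma dual_separates:
  fixes x y :: "'v::complex_normed_vector"
  assumes "\<And>\<phi> :: 'v \<Rightarrow> complex. bounded_clinear \<phi> \<Longrightarrow> \<phi> x = \<phi> y"
  shows "x = y"
proof -
  obtain \<phi> where \<phi>: "\<phi> \<in> dual_ball 1" "\<phi> (x - y) = norm (x - y)"
    by (rule norming_functional)
  then have "\<phi> x = \<phi> y"
    by (intro assms[OF dual_ball_bounded_clinear[OF \<phi>(1)]])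
  moreover have "\<phi> (x - y) = \<phi> x - \<phi> y"
    using \<phi>(1) by (intro clinear_diff) (simp add: dual_ball_def)
  ultimately show ?thesis using \<phi>(2) by simp
qed

section \<open>Eigenvectors in finite-dimensional spaces of functions\<close>

text \<open>Gaussian elimination, one coordinate at a time: a vector with nonzero entry at i is the
  pivot and is spent on clearing that coordinate in all the others.\<close>

lemma nontrivial_linear_relation:
  fixes v :: "'k \<Rightarrow> 'i \<Rightarrow> 'f::field"
  assumes "finite I" "finite K" "card I < card K"
  shows "\<exists>c. (\<exists>k\<in>K. c k \<noteq> 0) \<and> (\<forall>i\<in>I. (\<Sum>k\<in>K. c k * v k i) = 0)"
  using assms
proof (induction I arbitrary: K v rule: finite_induct)
  case empty
  then have "K \<noteq> {}" by auto
  then show ?case by (intro exI[of _ "\<lambda>_. 1"]) auto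
next
  case (insert i I)
  show ?case
  proof (cases "\<forall>k\<in>K. v k i = 0")
    case True
    have "card I < card K"
      using insert.prems insert.hyps by simp
    with insert.IH[of K v] insert.prems obtain c where "\<exists>k\<in>K. c k \<noteq> 0"
      "\<And>j. j \<in> I \<Longrightarrow> (\<Sum>k\<in>K. c k * v k j) = 0" by blast
    with True show ?thesis by (intro exI[of _ c]) auto
  next
    case False
    then obtain p where p: "p \<in> K" "v p i \<noteq> 0" by blast
    define w where "w k j = v k j - v k i / v p i * v p j" for k j
    have "\<exists>c. (\<exists>k\<in>K - {p}. c k \<noteq> 0) \<and> (\<forall>j\<in>I. (\<Sum>k\<in>K - {p}. c k * w k j) = 0)"
      using insert.prems insert.hyps p by (intro insert.IH) auto
    then obtain c k0 where c: "k0 \<in> K - {p}" "c k0 \<noteq> 0"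
      "\<And>j. j \<in> I \<Longrightarrow> (\<Sum>k\<in>K - {p}. c k * w k j) = 0" by blast
    define s where "s = (\<Sum>k\<in>K - {p}. c k * v k i)"
    \<comment> \<open>The relation among the reduced vectors is lifted by giving the pivot exactly
      the coefficient that makes coordinate i cancel.\<close>
    define d where "d k = (if k = p then - s / v p i else c k)" for k
    have d: "(\<Sum>k\<in>K. d k * v k j) = (\<Sum>k\<in>K - {p}. c k * v k j) - s / v p i * v p j" for j
      using insert.prems p by (simp add: sum.remove[of K p] d_def cong: sum.cong_simp)
    have e: "(\<Sum>k\<in>K - {p}. c k * w k j) = (\<Sum>k\<in>K - {p}. c k * v k j) - s / v p i * v p j" for j
      unfolding w_def s_def
      by (simp add: sum_subtractf right_diff_distrib sum_divide_distrib sum_distrib_right mult.assoc)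
    have "(\<Sum>k\<in>K. d k * v k j) = 0" if "j \<in> insert i I" for j
    proof (cases "j = i")
      case True
      then show ?thesis using d[of i] p by (simp add: s_def)
    next
      case False
      then show ?thesis using d[of j] e[of j] c(3) that by simp
    qed
    moreover have "d k0 \<noteq> 0" "k0 \<in> K" using c by (auto simp: d_def)
    ultimately show ?thesis by blast
  qed
qed

text \<open>The finite set \<open>I\<close> of evaluations separates \<open>E\<close>, so \<open>E\<close> is finite-dimensional and some nonzero
  polynomial in \<open>S\<close> annihilates \<open>f\<close>; one of minimal degree yields the eigenfunction.\<close>

lemma eigenfunction_exists:
  fixes E :: "('i \<Rightarrow> complex) set" and S :: "('i \<Rightarrow> complex) \<Rightarrow> 'i \<Rightarrow> complex"
  assumes E_add: "\<And>f g. f \<in> E \<Longrightarrow> g \<in> E \<Longrightarrow> (\<lambda>i. f i + g i) \<in> E"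
    and E_scale: "\<And>c f. f \<in> E \<Longrightarrow> (\<lambda>i. c * f i) \<in> E"
    and E_S: "\<And>f. f \<in> E \<Longrightarrow> S f \<in> E"
    and S_add: "\<And>f g. S (\<lambda>i. f i + g i) = (\<lambda>i. S f i + S g i)"
    and S_scale: "\<And>c f. S (\<lambda>i. c * f i) = (\<lambda>i. c * S f i)"
    and I: "finite I" "\<And>f. f \<in> E \<Longrightarrow> (\<And>i. i \<in> I \<Longrightarrow> f i = 0) \<Longrightarrow> f = (\<lambda>_. 0)"
    and f: "f \<in> E" "f \<noteq> (\<lambda>_. 0)"
  obtains g \<alpha> where "g \<in> E" "g \<noteq> (\<lambda>_. 0)" "S g = (\<lambda>i. \<alpha> * g i)"
proof -
  have S0: "S (\<lambda>_. 0) = (\<lambda>_. 0)"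
    using S_scale[of 0 "\<lambda>_. 0"] by simp
  \<comment> \<open>Horner's scheme: \<open>ev p\<close> is p(S) f, so \<open>ev (monom 1 k)\<close>
    is the k-th iterate of S at f.\<close>
  define ev where "ev p = fold_coeffs (\<lambda>a h i. a * f i + S h i) p (\<lambda>_. 0)" for p
  have ev_0: "ev 0 = (\<lambda>_. 0)"
    by (simp add: ev_def)
  have ev_pCons: "ev (pCons a p) = (\<lambda>i. a * f i + S (ev p) i)" for a p
    by (cases "a = 0 \<and> p = 0") (auto simp: ev_def S0)
  have ev_E: "ev p \<in> E" for p
  proof (induction p)
    case 0
    show ?case using E_scale[OF f(1), of 0] by (simp add: ev_0)
  next
    case (pCons a p)
    then show ?case unfolding ev_pCons by (intro E_add E_scale E_S f)
  qed
  have ev_add: "ev (p + q) = (\<lambda>i. ev p i + ev q i)" for p q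
    by (induction p q rule: poly_induct2) (simp_all add: ev_0 ev_pCons S_add algebra_simps)
  have ev_smult: "ev (smult c p) = (\<lambda>i. c * ev p i)" for c p
    by (induction p) (simp_all add: ev_0 ev_pCons S_scale algebra_simps)
  have ev_sum: "ev (sum h J) = (\<lambda>i. \<Sum>j\<in>J. ev (h j) i)" for h and J :: "nat set"
    by (induction J rule: infinite_finite_induct) (simp_all add: ev_0 ev_add)
  have ev_monom: "ev (monom c k) = (\<lambda>i. c * ev (monom 1 k) i)" for c k
    using ev_smult[of c "monom 1 k"] by (simp add: smult_monom)
  \<comment> \<open>The \<open>card I + 1\<close> iterates of f, restricted to I, outnumber the
    coordinates, and functions in E are determined by their restriction.\<close>
  obtain c where c: "\<exists>k\<in>{..card I}. c k \<noteq> 0"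
    "\<And>i. i \<in> I \<Longrightarrow> (\<Sum>k\<le>card I. c k * ev (monom 1 k) i) = 0"
    using nontrivial_linear_relation[OF I(1), of "{..card I}" "\<lambda>k. ev (monom 1 k)"] by auto
  define p where "p = (\<Sum>k\<le>card I. monom (c k) k)"
  obtain k where "k \<le> card I" "c k \<noteq> 0" using c(1) by auto
  then have "coeff p k \<noteq> 0"
    by (simp add: p_def coeff_sum if_distrib cong: if_cong)
  then have "p \<noteq> 0" by auto
  moreover have "ev p = (\<lambda>_. 0)"
  proof (rule I(2)[OF ev_E])
    show "ev p i = 0" if "i \<in> I" for i
      using c(2)[OF that] by (simp add: p_def ev_sum fun_cong[OF ev_monom, symmetric])
  qed
  ultimately have ex: "\<exists>p. p \<noteq> 0 \<and> ev p = (\<lambda>_. 0)" by blast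
  obtain p where p: "p \<noteq> 0" "ev p = (\<lambda>_. 0)"
    and min: "\<And>q. q \<noteq> 0 \<Longrightarrow> ev q = (\<lambda>_. 0) \<Longrightarrow> degree p \<le> degree q"
  proof -
    obtain p0 where "p0 \<noteq> 0 \<and> ev p0 = (\<lambda>_. 0)" using ex by blast
    from ex_has_least_nat[of "\<lambda>p. p \<noteq> 0 \<and> ev p = (\<lambda>_. 0)", OF this, of degree] that
    show thesis by (elim exE conjE) simp
  qed
  have "\<not> constant (poly p)"
  proof
    assume "constant (poly p)"
    then have "degree p = 0" by (simp add: constant_degree)
    then obtain a where "p = [:a:]" by (rule degree_eq_zeroE)
    with p f(2) show False
      by (simp add: ev_pCons ev_0 S0 fun_eq_iff)
  qed
  then obtain \<alpha> where "poly p \<alpha> = 0"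
    using fundamental_theorem_of_algebra by blast
  \<comment> \<open>Splitting off the root leaves q of smaller degree, so q(S) f is nonzero by
    minimality, while S - \<alpha> annihilates it.\<close>
  then obtain q where q: "p = [:- \<alpha>, 1:] * q"
    by (auto simp: poly_eq_0_iff_dvd)
  with p(1) have "q \<noteq> 0" by auto
  have "degree p = degree q + 1"
    using q \<open>q \<noteq> 0\<close> by (simp add: degree_mult_eq del: mult_pCons_left)
  with min[OF \<open>q \<noteq> 0\<close>] have "ev q \<noteq> (\<lambda>_. 0)" by auto
  moreover have "p = smult (- \<alpha>) q + pCons 0 q"
    using q by simp
  then have "S (ev q) = (\<lambda>i. \<alpha> * ev q i)"
    using p(2) by (simp only: ev_add ev_smult ev_pCons) (simp add: fun_eq_iff)
  ultimately show thesis
    using that[OF ev_E] by blast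
qed

section \<open>Compact operators\<close>

lemma compact_operator_bounded:
  assumes "compact_operator A"
  obtains a where "a > 0" "\<And>x. norm (A x) \<le> a * norm x"
proof -
  have cl: "clinear A"
    using assms by (simp add: compact_operator_def)
  have "bounded (A ` cball 0 1)"
    using assms bounded_subset[OF compact_imp_bounded closure_subset]
    unfolding compact_operator_def by blast
  then obtain a where a: "a > 0" "\<And>x. norm x \<le> 1 \<Longrightarrow> norm (A x) \<le> a"
    by (auto simp: bounded_pos)
  have "norm (A x) \<le> a * norm x" for x
  proof (cases "x = 0")
    case False
    then have "norm (A ((1 / norm x) *\<^sub>R x)) \<le> a"
      by (intro a(2)) simp
    with False show ?thesis
      by (simp add: clinear_scaleR[OF cl] field_simps)
  qed (simp add: clinear_0[OF cl])
  with a(1) that show thesis by blast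
qed

lemma compact_operator_bounded_clinear:
  assumes "compact_operator A"
  shows "bounded_clinear A"
proof -
  obtain a where "\<And>x. norm (A x) \<le> a * norm x"
    using compact_operator_bounded[OF assms] by blast
  then show ?thesis
    using assms by (intro bounded_clinearI[where K = a]) (auto simp: compact_operator_def clinear_iff)
qed

text \<open>This is Schauder's theorem that the adjoint is compact.\<close>

lemma compact_operator_dual_net:
  fixes A :: "'v::complex_normed_vector \<Rightarrow> 'v"
  assumes A: "compact_operator A" and d: "d > 0"
  obtains \<Xi> where "finite \<Xi>" "\<Xi> \<subseteq> dual_ball 1"
    "\<And>\<phi>. \<phi> \<in> dual_ball 1 \<Longrightarrow> \<exists>\<xi>\<in>\<Xi>. (\<lambda>x. \<phi> (A x) - \<xi> (A x)) \<in> dual_ball d"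
proof -
  have cl: "clinear A" and "compact (closure (A ` cball 0 1))"
    using A by (simp_all add: compact_operator_def)
  then obtain F where F: "finite F" "closure (A ` cball 0 1) \<subseteq> (\<Union>x\<in>F. ball x (d / 3))"
    using d unfolding compact_eq_totally_bounded by (metis divide_pos_pos zero_less_numeral)
  \<comment> \<open>D rounds the values of a functional on the finite net F to cells of side d / 6.
    Functionals in the unit ball are bounded by \<open>norm a\<close> at a, so only finitely many
    patterns occur.\<close>
  define D where "D \<phi> = (\<lambda>a\<in>F. (\<lfloor>6 / d * Re (\<phi> a)\<rfloor>, \<lfloor>6 / d * Im (\<phi> a)\<rfloor>))" for \<phi> :: "'v \<Rightarrow> complex"
  define J where "J a = {\<lfloor>- (6 / d * norm a)\<rfloor>..\<lfloor>6 / d * norm a\<rfloor>}" for a :: 'v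
  have "D \<phi> \<in> PiE F (\<lambda>a. J a \<times> J a)" if \<phi>: "\<phi> \<in> dual_ball 1" for \<phi>
  proof -
    have "\<bar>Re (\<phi> a)\<bar> \<le> norm a" "\<bar>Im (\<phi> a)\<bar> \<le> norm a" for a
      using \<phi> abs_Re_le_cmod[of "\<phi> a"] abs_Im_le_cmod[of "\<phi> a"]
      by (auto simp: dual_ball_def intro: order_trans)
    then have "6 / d * Re (\<phi> a) \<le> 6 / d * norm a" "6 / d * (- norm a) \<le> 6 / d * Re (\<phi> a)"
      "6 / d * Im (\<phi> a) \<le> 6 / d * norm a" "6 / d * (- norm a) \<le> 6 / d * Im (\<phi> a)" for a
      using d by (intro mult_left_mono; simp add: abs_le_iff minus_le_iff)+
    then have "\<lfloor>6 / d * Re (\<phi> a)\<rfloor> \<in> J a" "\<lfloor>6 / d * Im (\<phi> a)\<rfloor> \<in> J a" for a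
      unfolding J_def atLeastAtMost_iff by (auto intro!: floor_mono simp del: times_divide_eq_left)
    then show ?thesis by (auto simp: D_def)
  qed
  then have "D ` dual_ball 1 \<subseteq> PiE F (\<lambda>a. J a \<times> J a)" by blast
  moreover have "finite (PiE F (\<lambda>a. J a \<times> J a))"
    using F(1) by (intro finite_PiE) (auto simp: J_def)
  ultimately have "finite (D ` dual_ball 1)"
    by (rule finite_subset)
  \<comment> \<open>One functional is kept for each pattern that occurs, so the net consists of
    members of the unit ball.\<close>
  then obtain \<Xi> where \<Xi>: "finite \<Xi>" "\<Xi> \<subseteq> dual_ball 1" "D ` dual_ball 1 = D ` \<Xi>"
    using finite_subset_image[of "D ` dual_ball 1" D "dual_ball 1"] by auto
  have fl: "\<bar>s - t\<bar> \<le> d / 6" if "\<lfloor>6 / d * s\<rfloor> = \<lfloor>6 / d * t\<rfloor>" for s t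
  proof -
    have "\<bar>6 / d * s - 6 / d * t\<bar> < 1"
      using that by linarith
    then have "6 / d * \<bar>s - t\<bar> < 1"
      using d unfolding right_diff_distrib[symmetric] abs_mult by simp
    with d show ?thesis by (simp add: field_simps)
  qed
  have "\<exists>\<xi>\<in>\<Xi>. (\<lambda>x. \<phi> (A x) - \<xi> (A x)) \<in> dual_ball d" if \<phi>: "\<phi> \<in> dual_ball 1" for \<phi>
  proof -
    obtain \<xi> where \<xi>: "\<xi> \<in> \<Xi>" "D \<phi> = D \<xi>"
      using \<Xi>(3) \<phi> by blast
    then have \<xi>1: "\<xi> \<in> dual_ball 1" using \<Xi> by blast
    have lin: "clinear \<phi>" "clinear \<xi>" and le: "cmod (\<phi> x) \<le> norm x" "cmod (\<xi> x) \<le> norm x" for x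
      using \<phi> \<xi>1 by (auto simp: dual_ball_def)
    have F_le: "cmod (\<phi> a - \<xi> a) \<le> d / 3" if "a \<in> F" for a
    proof -
      have "D \<phi> a = D \<xi> a" using \<xi>(2) by simp
      with that have "\<lfloor>6 / d * Re (\<phi> a)\<rfloor> = \<lfloor>6 / d * Re (\<xi> a)\<rfloor>"
        "\<lfloor>6 / d * Im (\<phi> a)\<rfloor> = \<lfloor>6 / d * Im (\<xi> a)\<rfloor>"
        by (simp_all add: D_def)
      from fl[OF this(1)] fl[OF this(2)]
      have "\<bar>Re (\<phi> a) - Re (\<xi> a)\<bar> \<le> d / 6" "\<bar>Im (\<phi> a) - Im (\<xi> a)\<bar> \<le> d / 6" .
      then show ?thesis
        using cmod_le[of "\<phi> a - \<xi> a"] by simp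
    qed
    have unit: "cmod (\<phi> (A x) - \<xi> (A x)) \<le> d" if "norm x \<le> 1" for x
    proof -
      have "A x \<in> closure (A ` cball 0 1)"
        using that closure_subset by fastforce
      then obtain a where a: "a \<in> F" "norm (A x - a) < d / 3"
        using F(2) by (auto simp: dist_norm norm_minus_commute)
      have "\<phi> (A x) - \<xi> (A x) = \<phi> (A x - a) + (\<phi> a - \<xi> a) - \<xi> (A x - a)"
        using lin by (simp add: clinear_diff)
      also have "cmod \<dots> \<le> cmod (\<phi> (A x - a)) + cmod (\<phi> a - \<xi> a) + cmod (\<xi> (A x - a))"
        by (meson norm_triangle_ineq norm_triangle_ineq4 add_mono order_trans order_refl)
      \<comment> \<open>Three thirds: real and imaginary part differ by at most d / 6 each at the
        net point a, and moving from A x to a costs d / 3 for either functional.\<close>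
      also have "\<dots> \<le> d"
        using le[of "A x - a"] F_le[OF a(1)] a(2) by linarith
      finally show ?thesis .
    qed
    have "cmod (\<phi> (A x) - \<xi> (A x)) \<le> d * norm x" for x
    proof (cases "x = 0")
      case False
      let ?y = "(1 / norm x) *\<^sub>R x"
      from False have "cmod (\<phi> (A ?y) - \<xi> (A ?y)) \<le> d"
        by (intro unit) simp
      also have "\<phi> (A ?y) - \<xi> (A ?y) = (1 / norm x) *\<^sub>R (\<phi> (A x) - \<xi> (A x))"
        by (simp add: clinear_scaleR[OF cl] clinear_scaleR[OF lin(1)] clinear_scaleR[OF lin(2)]
            scaleR_diff_right del: scaleR_conv_of_real)
      also have "cmod \<dots> = cmod (\<phi> (A x) - \<xi> (A x)) / norm x"
        by simp
      finally show ?thesis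
        using False by (simp add: field_simps)
    qed (simp add: clinear_0 cl lin)
    then have "(\<lambda>x. \<phi> (A x) - \<xi> (A x)) \<in> dual_ball d"
      using lin cl by (auto simp: dual_ball_def clinear_iff scaleC_complex_def algebra_simps)
    with \<xi> show ?thesis by blast
  qed
  with \<Xi> that show thesis by blast
qed

section \<open>Bilinear forms on the dual\<close>

text \<open>An element \<open>z\<close> of a tensor product gives the form \<open>(\<psi>, \<phi>) \<mapsto> (\<psi> \<otimes> \<phi>) z\<close>. Both partial
  forms are evaluations at vectors of the space, not just elements of the bidual.\<close>

definition tensor_forms :: "(('v::complex_normed_vector \<Rightarrow> complex) \<times> ('v \<Rightarrow> complex) \<Rightarrow> complex) set" where
  "tensor_forms = {b. (\<forall>\<psi> \<phi>. \<not> (bounded_clinear \<psi> \<and> bounded_clinear \<phi>) \<longrightarrow> b (\<psi>, \<phi>) = 0) \<and>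
    (\<forall>\<phi>. bounded_clinear \<phi> \<longrightarrow> (\<exists>x. \<forall>\<psi>. bounded_clinear \<psi> \<longrightarrow> b (\<psi>, \<phi>) = \<psi> x)) \<and>
    (\<forall>\<psi>. bounded_clinear \<psi> \<longrightarrow> (\<exists>y. \<forall>\<phi>. bounded_clinear \<phi> \<longrightarrow> b (\<psi>, \<phi>) = \<phi> y)) \<and>
    (\<exists>K. \<forall>\<psi>\<in>dual_ball 1. \<forall>\<phi>\<in>dual_ball 1. cmod (b (\<psi>, \<phi>)) \<le> K)}"

lemma
  assumes "b \<in> tensor_forms"
  shows tensor_forms_outside: "\<not> (bounded_clinear \<psi> \<and> bounded_clinear \<phi>) \<Longrightarrow> b (\<psi>, \<phi>) = 0"
    and tensor_forms_left: "bounded_clinear \<phi> \<Longrightarrow> \<exists>x. \<forall>\<psi>. bounded_clinear \<psi> \<longrightarrow> b (\<psi>, \<phi>) = \<psi> x"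
    and tensor_forms_right: "bounded_clinear \<psi> \<Longrightarrow> \<exists>y. \<forall>\<phi>. bounded_clinear \<phi> \<longrightarrow> b (\<psi>, \<phi>) = \<phi> y"
    and tensor_forms_bound: "\<exists>K. \<forall>\<psi>\<in>dual_ball 1. \<forall>\<phi>\<in>dual_ball 1. cmod (b (\<psi>, \<phi>)) \<le> K"
  using assms unfolding tensor_forms_def by blast+

lemma bounded_clinear_lincomb:
  fixes f g :: "'v::complex_normed_vector \<Rightarrow> complex"
  assumes "bounded_clinear f" "bounded_clinear g"
  shows "bounded_clinear (\<lambda>x. c * f x + d * g x)"
proof -
  have "bounded_linear (\<lambda>x. c * f x + d * g x)"
    using assms by (intro bounded_linear_add bounded_linear_const_mult) (auto simp: bounded_clinear_def)
  then show ?thesis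
    using assms by (auto simp: bounded_clinear_def clinear_iff scaleC_complex_def algebra_simps)
qed

text \<open>Bilinearity is inherited from the representing vectors: with one argument fixed, the
  form is evaluation at a point.\<close>

lemma
  assumes b: "b \<in> tensor_forms" and f: "bounded_clinear f" "bounded_clinear g" "bounded_clinear h"
  shows tensor_forms_lincomb_left: "b (\<lambda>x. c * f x + d * g x, h) = c * b (f, h) + d * b (g, h)"
    and tensor_forms_lincomb_right: "b (h, \<lambda>x. c * f x + d * g x) = c * b (h, f) + d * b (h, g)"
proof -
  obtain x where "\<And>\<psi>. bounded_clinear \<psi> \<Longrightarrow> b (\<psi>, h) = \<psi> x"
    using tensor_forms_left[OF b f(3)] by blast
  then show "b (\<lambda>x. c * f x + d * g x, h) = c * b (f, h) + d * b (g, h)"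
    using f by (simp add: bounded_clinear_lincomb)
  obtain y where "\<And>\<phi>. bounded_clinear \<phi> \<Longrightarrow> b (h, \<phi>) = \<phi> y"
    using tensor_forms_right[OF b f(3)] by blast
  then show "b (h, \<lambda>x. c * f x + d * g x) = c * b (h, f) + d * b (h, g)"
    using f by (simp add: bounded_clinear_lincomb)
qed

lemma tensor_forms_scaled_bound:
  assumes b: "b \<in> tensor_forms"
    and N: "\<And>\<psi> \<phi>. \<psi> \<in> dual_ball 1 \<Longrightarrow> \<phi> \<in> dual_ball 1 \<Longrightarrow> cmod (b (\<psi>, \<phi>)) \<le> N"
    and c: "\<psi> \<in> dual_ball c" "c > 0" and d: "\<phi> \<in> dual_ball d" "d > 0"
  shows "cmod (b (\<psi>, \<phi>)) \<le> N * c * d"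
proof -
  let ?\<psi> = "\<lambda>x. complex_of_real (1 / c) * \<psi> x" and ?\<phi> = "\<lambda>x. complex_of_real (1 / d) * \<phi> x"
  note n = dual_ball_normalize[OF c] dual_ball_normalize[OF d]
  note bc = n[THEN dual_ball_bounded_clinear] c(1)[THEN dual_ball_bounded_clinear]
    d(1)[THEN dual_ball_bounded_clinear]
  have "b (?\<psi>, ?\<phi>) = complex_of_real (1 / c) * b (\<psi>, ?\<phi>)"
    using tensor_forms_lincomb_left[OF b bc(3,3,2), of "complex_of_real (1 / c)" 0] by simp
  also have "b (\<psi>, ?\<phi>) = complex_of_real (1 / d) * b (\<psi>, \<phi>)"
    using tensor_forms_lincomb_right[OF b bc(4,4,3), of "complex_of_real (1 / d)" 0] by simp
  finally have "cmod (b (?\<psi>, ?\<phi>)) = cmod (b (\<psi>, \<phi>)) / (c * d)"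
    using c d by (simp add: norm_mult norm_divide)
  with N[OF n] have "cmod (b (\<psi>, \<phi>)) / (c * d) \<le> N"
    by simp
  with c d show ?thesis
    by (simp add: pos_divide_le_eq mult.assoc)
qed

lemma tensor_forms_add:
  assumes f: "f \<in> tensor_forms" and g: "g \<in> tensor_forms"
  shows "(\<lambda>p. f p + g p) \<in> tensor_forms"
proof -
  have "\<exists>x. \<forall>\<psi>. bounded_clinear \<psi> \<longrightarrow> f (\<psi>, \<phi>) + g (\<psi>, \<phi>) = \<psi> x" if \<phi>: "bounded_clinear \<phi>" for \<phi>
  proof -
    obtain x x' where "\<And>\<psi>. bounded_clinear \<psi> \<Longrightarrow> f (\<psi>, \<phi>) = \<psi> x"
      "\<And>\<psi>. bounded_clinear \<psi> \<Longrightarrow> g (\<psi>, \<phi>) = \<psi> x'"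
      using tensor_forms_left[OF f \<phi>] tensor_forms_left[OF g \<phi>] by blast
    then show ?thesis
      by (intro exI[of _ "x + x'"]) (auto simp: bounded_clinear_def clinear_add)
  qed
  moreover have "\<exists>y. \<forall>\<phi>. bounded_clinear \<phi> \<longrightarrow> f (\<psi>, \<phi>) + g (\<psi>, \<phi>) = \<phi> y"
    if \<psi>: "bounded_clinear \<psi>" for \<psi>
  proof -
    obtain y y' where "\<And>\<phi>. bounded_clinear \<phi> \<Longrightarrow> f (\<psi>, \<phi>) = \<phi> y"
      "\<And>\<phi>. bounded_clinear \<phi> \<Longrightarrow> g (\<psi>, \<phi>) = \<phi> y'"
      using tensor_forms_right[OF f \<psi>] tensor_forms_right[OF g \<psi>] by blast
    then show ?thesis
      by (intro exI[of _ "y + y'"]) (auto simp: bounded_clinear_def clinear_add)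
  qed
  moreover have "\<exists>K. \<forall>\<psi>\<in>dual_ball 1. \<forall>\<phi>\<in>dual_ball 1. cmod (f (\<psi>, \<phi>) + g (\<psi>, \<phi>)) \<le> K"
  proof -
    obtain K K' where "\<forall>\<psi>\<in>dual_ball 1. \<forall>\<phi>\<in>dual_ball 1. cmod (f (\<psi>, \<phi>)) \<le> K"
      "\<forall>\<psi>\<in>dual_ball 1. \<forall>\<phi>\<in>dual_ball 1. cmod (g (\<psi>, \<phi>)) \<le> K'"
      using tensor_forms_bound[OF f] tensor_forms_bound[OF g] by blast
    then show ?thesis
      by (intro exI[of _ "K + K'"]) (meson norm_triangle_mono)
  qed
  ultimately show ?thesis
    using tensor_forms_outside[OF f] tensor_forms_outside[OF g]
    unfolding tensor_forms_def by simp
qed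

lemma tensor_forms_scale:
  assumes f: "f \<in> tensor_forms"
  shows "(\<lambda>p. c * f p) \<in> tensor_forms"
proof -
  have "\<exists>x. \<forall>\<psi>. bounded_clinear \<psi> \<longrightarrow> c * f (\<psi>, \<phi>) = \<psi> x" if \<phi>: "bounded_clinear \<phi>" for \<phi>
  proof -
    obtain x where "\<And>\<psi>. bounded_clinear \<psi> \<Longrightarrow> f (\<psi>, \<phi>) = \<psi> x"
      using tensor_forms_left[OF f \<phi>] by blast
    then show ?thesis
      by (intro exI[of _ "c *\<^sub>C x"]) (auto simp: bounded_clinear_def clinear_scaleC scaleC_complex_def)
  qed
  moreover have "\<exists>y. \<forall>\<phi>. bounded_clinear \<phi> \<longrightarrow> c * f (\<psi>, \<phi>) = \<phi> y" if \<psi>: "bounded_clinear \<psi>" for \<psi>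
  proof -
    obtain y where "\<And>\<phi>. bounded_clinear \<phi> \<Longrightarrow> f (\<psi>, \<phi>) = \<phi> y"
      using tensor_forms_right[OF f \<psi>] by blast
    then show ?thesis
      by (intro exI[of _ "c *\<^sub>C y"]) (auto simp: bounded_clinear_def clinear_scaleC scaleC_complex_def)
  qed
  moreover have "\<exists>K. \<forall>\<psi>\<in>dual_ball 1. \<forall>\<phi>\<in>dual_ball 1. cmod (c * f (\<psi>, \<phi>)) \<le> K"
  proof -
    obtain K where "\<forall>\<psi>\<in>dual_ball 1. \<forall>\<phi>\<in>dual_ball 1. cmod (f (\<psi>, \<phi>)) \<le> K"
      using tensor_forms_bound[OF f] by blast
    then show ?thesis
      by (intro exI[of _ "cmod c * K"]) (simp add: norm_mult mult_left_mono)
  qed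
  ultimately show ?thesis
    using tensor_forms_outside[OF f] unfolding tensor_forms_def by simp
qed

text \<open>The guard keeps the result zero outside the bounded linear functionals, for \<psi>
  \<circ> A may be bounded and linear although \<psi> is not. In the other argument f vanishes there
  by itself. The right partial form of the result is that of f at \<psi> \<circ> A; the left one is
  evaluation at the image under A of the old vector.\<close>

lemma tensor_forms_compose_left:
  assumes f: "f \<in> tensor_forms" and A: "bounded_clinear A"
  shows "(\<lambda>(\<psi>, \<phi>). if bounded_clinear \<psi> then f (\<lambda>x. \<psi> (A x), \<phi>) else 0) \<in> tensor_forms"
proof -
  note comp = bounded_clinear_compose[OF _ A]
  have "\<exists>x. \<forall>\<psi>. bounded_clinear \<psi> \<longrightarrow> f (\<lambda>x. \<psi> (A x), \<phi>) = \<psi> x" if \<phi>: "bounded_clinear \<phi>" for \<phi>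
  proof -
    obtain x where "\<And>\<psi>. bounded_clinear \<psi> \<Longrightarrow> f (\<psi>, \<phi>) = \<psi> x"
      using tensor_forms_left[OF f \<phi>] by blast
    then show ?thesis
      by (intro exI[of _ "A x"]) (simp add: comp)
  qed
  moreover have "\<exists>K. \<forall>\<psi>\<in>dual_ball 1. \<forall>\<phi>\<in>dual_ball 1. cmod (f (\<lambda>x. \<psi> (A x), \<phi>)) \<le> K"
  proof -
    obtain K where K: "\<And>\<psi> \<phi>. \<psi> \<in> dual_ball 1 \<Longrightarrow> \<phi> \<in> dual_ball 1 \<Longrightarrow> cmod (f (\<psi>, \<phi>)) \<le> K"
      using tensor_forms_bound[OF f] by blast
    obtain a where a: "a > 0" "\<And>x. norm (A x) \<le> norm x * a"
      using A bounded_linear.pos_bounded unfolding bounded_clinear_def by blast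
    have "(\<lambda>x. \<psi> (A x)) \<in> dual_ball a" if "\<psi> \<in> dual_ball 1" for \<psi> :: "'a \<Rightarrow> complex"
    proof -
      have "cmod (\<psi> (A x)) \<le> a * norm x" for x
        using that a(2)[of x] by (auto simp: dual_ball_def mult.commute intro: order_trans)
      then show ?thesis
        using that A by (auto simp: dual_ball_def bounded_clinear_def clinear_iff)
    qed
    then show ?thesis
      using a(1) by (intro exI[of _ "K * a * 1"] ballI tensor_forms_scaled_bound[OF f K]) simp_all
  qed
  moreover have "f (\<lambda>x. \<psi> (A x), \<phi>) = 0" if "\<not> bounded_clinear \<phi>" for \<psi> \<phi>
    using tensor_forms_outside[OF f] that by blast
  moreover have "\<exists>y. \<forall>\<phi>. bounded_clinear \<phi> \<longrightarrow> f (\<lambda>x. \<psi> (A x), \<phi>) = \<phi> y"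
    if "bounded_clinear \<psi>" for \<psi> :: "'a \<Rightarrow> complex"
    by (rule tensor_forms_right[OF f comp[OF that]])
  ultimately show ?thesis
    unfolding tensor_forms_def by (auto simp: dual_ball_bounded_clinear)
qed

text \<open>By Schauder's theorem, \<open>A \<otimes> A\<close> is compact for the injective norm, so its eigenforms for a
  nonzero eigenvalue are determined by finitely many values.\<close>

lemma eigenforms_finite_determined:
  fixes A :: "'v::complex_normed_vector \<Rightarrow> 'v"
  assumes A: "compact_operator A" and l: "\<kappa> \<noteq> 0"
  obtains \<Xi> where "finite \<Xi>"
    "\<And>f. f \<in> tensor_forms \<Longrightarrow>
      (\<And>\<psi> \<phi>. bounded_clinear \<psi> \<Longrightarrow> bounded_clinear \<phi> \<Longrightarrow>
        f (\<lambda>x. \<psi> (A x), \<lambda>x. \<phi> (A x)) = \<kappa> * f (\<psi>, \<phi>)) \<Longrightarrow>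
      (\<And>p. p \<in> \<Xi> \<times> \<Xi> \<Longrightarrow> f p = 0) \<Longrightarrow> f = (\<lambda>_. 0)"
proof -
  have bA: "bounded_clinear A" and clA: "clinear A"
    using A by (auto simp: compact_operator_bounded_clinear compact_operator_def)
  obtain a where a: "a > 0" "\<And>x. norm (A x) \<le> a * norm x"
    using compact_operator_bounded[OF A] by blast
  \<comment> \<open>Chosen for the halving below: two error terms of size N * d * a add up to
    |\<kappa>| * N / 2, and division by \<kappa> leaves N / 2.\<close>
  define d where "d = cmod \<kappa> / (4 * a)"
  have d: "d > 0" using a l by (simp add: d_def)
  obtain \<Xi> where \<Xi>: "finite \<Xi>" "\<Xi> \<subseteq> dual_ball 1"
    "\<And>\<phi>. \<phi> \<in> dual_ball 1 \<Longrightarrow> \<exists>\<xi>\<in>\<Xi>. (\<lambda>x. \<phi> (A x) - \<xi> (A x)) \<in> dual_ball d"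
    by (rule compact_operator_dual_net[OF A d], rule that)
  have adj: "(\<lambda>x. \<psi> (A x)) \<in> dual_ball a" if "\<psi> \<in> dual_ball 1" for \<psi> :: "'v \<Rightarrow> complex"
  proof -
    have "cmod (\<psi> (A x)) \<le> a * norm x" for x
      using that a(2)[of x] by (auto simp: dual_ball_def intro: order_trans)
    then show ?thesis
      using that clA by (auto simp: dual_ball_def clinear_iff)
  qed
  have "f = (\<lambda>_. 0)" if f: "f \<in> tensor_forms"
    and eq: "\<And>\<psi> \<phi>. bounded_clinear \<psi> \<Longrightarrow> bounded_clinear \<phi> \<Longrightarrow>
        f (\<lambda>x. \<psi> (A x), \<lambda>x. \<phi> (A x)) = \<kappa> * f (\<psi>, \<phi>)"
    and zero: "\<And>p. p \<in> \<Xi> \<times> \<Xi> \<Longrightarrow> f p = 0" for f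
  proof -
    \<comment> \<open>Any bound N on the unit balls may be halved, hence iteration forces the form
      to vanish. In passing from (\<psi> \<circ> A, \<phi> \<circ> A) to (\<xi> \<circ> A, \<eta>
      \<circ> A) one argument is replaced at a time, and the value reached is \<kappa> times f at a
      point of the net, that is 0.\<close>
    have half: "cmod (f (\<psi>, \<phi>)) \<le> N / 2" if N: "\<And>\<psi> \<phi>. \<psi> \<in> dual_ball 1 \<Longrightarrow> \<phi> \<in> dual_ball 1 \<Longrightarrow> cmod (f (\<psi>, \<phi>)) \<le> N"
      and \<psi>: "\<psi> \<in> dual_ball 1" and \<phi>: "\<phi> \<in> dual_ball 1" for N \<psi> \<phi>
    proof -
      obtain \<xi> \<eta> where \<xi>: "\<xi> \<in> \<Xi>" "(\<lambda>x. \<psi> (A x) - \<xi> (A x)) \<in> dual_ball d"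
        and \<eta>: "\<eta> \<in> \<Xi>" "(\<lambda>x. \<phi> (A x) - \<eta> (A x)) \<in> dual_ball d"
        using \<Xi>(3) \<psi> \<phi> by meson
      have ball: "\<xi> \<in> dual_ball 1" "\<eta> \<in> dual_ball 1" using \<Xi>(2) \<xi> \<eta> by auto
      note bc = dual_ball_bounded_clinear[OF \<psi>] dual_ball_bounded_clinear[OF \<phi>]
        dual_ball_bounded_clinear[OF ball(1)] dual_ball_bounded_clinear[OF ball(2)]
      note bcA = bc[THEN bounded_clinear_compose[OF _ bA]]
      let ?s = "\<lambda>x. \<psi> (A x) - \<xi> (A x)" and ?t = "\<lambda>x. \<phi> (A x) - \<eta> (A x)"
      have "\<kappa> * f (\<psi>, \<phi>) = f (\<lambda>x. \<psi> (A x), \<lambda>x. \<phi> (A x)) - \<kappa> * f (\<xi>, \<eta>)"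
        using eq bc zero \<xi> \<eta> by simp
      also have "\<dots> = f (?s, \<lambda>x. \<phi> (A x)) + f (\<lambda>x. \<xi> (A x), ?t)"
        using tensor_forms_lincomb_left[OF f bcA(1,3,2), of 1 "-1"]
          tensor_forms_lincomb_right[OF f bcA(2,4,3), of 1 "-1"] eq[OF bc(3,4)] by simp
      also have "cmod \<dots> \<le> N * d * a + N * a * d"
        using a(1) d by (intro norm_triangle_mono tensor_forms_scaled_bound[OF f N] \<xi> \<eta> adj \<phi> ball)
      also have "\<dots> = cmod \<kappa> * (N / 2)"
        using a(1) by (simp add: d_def)
      finally show ?thesis
        using l by (simp add: norm_mult)
    qed
    obtain K where K: "\<And>\<psi> \<phi>. \<psi> \<in> dual_ball 1 \<Longrightarrow> \<phi> \<in> dual_ball 1 \<Longrightarrow> cmod (f (\<psi>, \<phi>)) \<le> K"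
      using tensor_forms_bound[OF f] by blast
    have le: "cmod (f (\<psi>, \<phi>)) \<le> K * (1 / 2) ^ n" if "\<psi> \<in> dual_ball 1" "\<phi> \<in> dual_ball 1" for n \<psi> \<phi>
      using that
    proof (induction n arbitrary: \<psi> \<phi>)
      case (Suc n)
      have "cmod (f (\<psi>, \<phi>)) \<le> K * (1 / 2) ^ n / 2"
        by (rule half) (rule Suc.IH Suc.prems | assumption)+
      then show ?case by simp
    qed (simp add: K)
    have "(\<lambda>n. K * (1 / 2) ^ n) \<longlonglongrightarrow> 0"
      by (intro tendsto_mult_right_zero LIMSEQ_power_zero) simp
    then have z: "cmod (f (\<psi>, \<phi>)) \<le> 0" if "\<psi> \<in> dual_ball 1" "\<phi> \<in> dual_ball 1" for \<psi> \<phi>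
      using le[OF that] by (intro LIMSEQ_le_const) auto
    have "f (\<psi>, \<phi>) = 0" for \<psi> \<phi>
    proof (cases "bounded_clinear \<psi> \<and> bounded_clinear \<phi>")
      case True
      obtain c where c: "c > 0" "\<psi> \<in> dual_ball c"
        by (rule bounded_clinear_dual_ball[OF conjunct1[OF True]], rule that)
      obtain e where e: "e > 0" "\<phi> \<in> dual_ball e"
        by (rule bounded_clinear_dual_ball[OF conjunct2[OF True]], rule that)
      have "cmod (f (\<psi>, \<phi>)) \<le> 0 * c * e"
        by (rule tensor_forms_scaled_bound[OF f]) (rule z c e | assumption)+
      then show ?thesis by simp
    qed (rule tensor_forms_outside[OF f])
    then show ?thesis by auto
  qed
  with \<Xi>(1) that show thesis by blast
qed

lemma eigenform_eigenvalues:
  fixes A :: "'v::complex_normed_vector \<Rightarrow> 'v"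
  assumes A: "compact_operator A" and l: "\<kappa> \<noteq> 0"
    and f: "f \<in> tensor_forms" "f \<noteq> (\<lambda>_. 0)"
    and eq: "\<And>\<psi> \<phi>. bounded_clinear \<psi> \<Longrightarrow> bounded_clinear \<phi> \<Longrightarrow>
        f (\<lambda>x. \<psi> (A x), \<lambda>x. \<phi> (A x)) = \<kappa> * f (\<psi>, \<phi>)"
  obtains \<alpha> \<beta> where "\<alpha> \<in> point_spectrum A" "\<beta> \<in> point_spectrum A" "\<kappa> = \<alpha> * \<beta>"
proof -
  have bA: "bounded_clinear A"
    by (rule compact_operator_bounded_clinear[OF A])
  note comp = bounded_clinear_compose[OF _ bA]
  define E where "E = {g \<in> tensor_forms. \<forall>\<psi> \<phi>. bounded_clinear \<psi> \<longrightarrow> bounded_clinear \<phi> \<longrightarrow>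
        g (\<lambda>x. \<psi> (A x), \<lambda>x. \<phi> (A x)) = \<kappa> * g (\<psi>, \<phi>)}"
  define S where "S g = (\<lambda>(\<psi>, \<phi>). if bounded_clinear \<psi> then g (\<lambda>x. \<psi> (A x), \<phi>) else 0)"
    for g :: "('v \<Rightarrow> complex) \<times> ('v \<Rightarrow> complex) \<Rightarrow> complex"
  obtain \<Xi> where \<Xi>: "finite \<Xi>"
    "\<And>g. g \<in> tensor_forms \<Longrightarrow>
      (\<And>\<psi> \<phi>. bounded_clinear \<psi> \<Longrightarrow> bounded_clinear \<phi> \<Longrightarrow>
        g (\<lambda>x. \<psi> (A x), \<lambda>x. \<phi> (A x)) = \<kappa> * g (\<psi>, \<phi>)) \<Longrightarrow>
      (\<And>p. p \<in> \<Xi> \<times> \<Xi> \<Longrightarrow> g p = 0) \<Longrightarrow> g = (\<lambda>_. 0)"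
    using eigenforms_finite_determined[OF A l] by metis
  obtain g \<alpha> where g: "g \<in> E" "g \<noteq> (\<lambda>_. 0)" "S g = (\<lambda>p. \<alpha> * g p)"
  proof (rule eigenfunction_exists[of E S "\<Xi> \<times> \<Xi>" f])
    show "(\<lambda>p. g p + h p) \<in> E" if "g \<in> E" "h \<in> E" for g h
      using that by (auto simp: E_def tensor_forms_add algebra_simps)
    show "(\<lambda>p. c * g p) \<in> E" if "g \<in> E" for g c
      using that by (auto simp: E_def tensor_forms_scale algebra_simps)
    show "S g \<in> E" if "g \<in> E" for g
    proof -
      have g: "g \<in> tensor_forms"
        "\<And>\<psi> \<phi>. bounded_clinear \<psi> \<Longrightarrow> bounded_clinear \<phi> \<Longrightarrow>
          g (\<lambda>x. \<psi> (A x), \<lambda>x. \<phi> (A x)) = \<kappa> * g (\<psi>, \<phi>)"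
        using that by (auto simp: E_def)
      from g(1) have "S g \<in> tensor_forms"
        unfolding S_def by (rule tensor_forms_compose_left[OF _ bA])
      moreover have "S g (\<lambda>x. \<psi> (A x), \<lambda>x. \<phi> (A x)) = \<kappa> * S g (\<psi>, \<phi>)"
        if "bounded_clinear \<psi>" "bounded_clinear \<phi>" for \<psi> \<phi>
        using that g(2)[OF comp[OF that(1)] that(2)] by (simp add: S_def comp)
      ultimately show ?thesis by (simp add: E_def)
    qed
    show "S (\<lambda>p. g p + h p) = (\<lambda>p. S g p + S h p)" for g h
      by (auto simp: S_def)
    show "S (\<lambda>p. c * g p) = (\<lambda>p. c * S g p)" for c g
      by (auto simp: S_def)
    show "finite (\<Xi> \<times> \<Xi>)" using \<Xi>(1) by simp
    show "g = (\<lambda>_. 0)" if "g \<in> E" "\<And>p. p \<in> \<Xi> \<times> \<Xi> \<Longrightarrow> g p = 0" for g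
      using that by (intro \<Xi>(2)) (auto simp: E_def)
    show "f \<in> E" using f(1) eq by (simp add: E_def)
  qed (use f in auto)
  have gt: "g \<in> tensor_forms"
    and geq: "\<And>\<psi> \<phi>. bounded_clinear \<psi> \<Longrightarrow> bounded_clinear \<phi> \<Longrightarrow>
        g (\<lambda>x. \<psi> (A x), \<lambda>x. \<phi> (A x)) = \<kappa> * g (\<psi>, \<phi>)"
    using g(1) by (auto simp: E_def)
  have galpha: "g (\<lambda>x. \<psi> (A x), \<phi>) = \<alpha> * g (\<psi>, \<phi>)" if "bounded_clinear \<psi>" for \<psi> \<phi>
    using that fun_cong[OF g(3), of "(\<psi>, \<phi>)"] by (simp add: S_def)
  obtain \<psi> \<phi> where ne: "g (\<psi>, \<phi>) \<noteq> 0"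
    using g(2) by fastforce
  then have \<psi>: "bounded_clinear \<psi>" and \<phi>: "bounded_clinear \<phi>"
    using tensor_forms_outside[OF gt] by blast+
  \<comment> \<open>Otherwise \<kappa> times the nonzero value g (\<psi>, \<phi>) would equal
    \<alpha> g (\<psi>, \<phi> \<circ> A) = 0. This permits the division that produces the second
    eigenvalue.\<close>
  have alpha0: "\<alpha> \<noteq> 0"
    using geq[OF \<psi> \<phi>] galpha[OF \<psi>, of "\<lambda>x. \<phi> (A x)"] ne l by auto
  have gbeta: "g (\<psi>, \<lambda>x. \<phi> (A x)) = \<kappa> / \<alpha> * g (\<psi>, \<phi>)" if "bounded_clinear \<phi>" for \<phi>
    using geq[OF \<psi> that] galpha[OF \<psi>, of "\<lambda>x. \<phi> (A x)"] alpha0 by (simp add: field_simps)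
  have scaleC: "\<psi> (c *\<^sub>C x) = c * \<psi> x" if "bounded_clinear \<psi>" for \<psi> :: "'v \<Rightarrow> complex" and c x
    using that by (simp add: bounded_clinear_def clinear_scaleC scaleC_complex_def)
  obtain x where x: "\<And>\<psi>. bounded_clinear \<psi> \<Longrightarrow> g (\<psi>, \<phi>) = \<psi> x"
    using tensor_forms_left[OF gt \<phi>] by blast
  have "A x = \<alpha> *\<^sub>C x"
  proof (rule dual_separates)
    fix \<psi>' :: "'v \<Rightarrow> complex" assume \<psi>': "bounded_clinear \<psi>'"
    show "\<psi>' (A x) = \<psi>' (\<alpha> *\<^sub>C x)"
      using x[OF comp[OF \<psi>']] galpha[OF \<psi>', of \<phi>] x[OF \<psi>'] scaleC[OF \<psi>'] by simp
  qed
  moreover have "x \<noteq> 0"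
    using ne x[OF \<psi>] \<psi> by (auto simp: bounded_clinear_def clinear_0)
  ultimately have "\<alpha> \<in> point_spectrum A"
    by (auto simp: point_spectrum_def)
  moreover
  obtain y where y: "\<And>\<phi>. bounded_clinear \<phi> \<Longrightarrow> g (\<psi>, \<phi>) = \<phi> y"
    using tensor_forms_right[OF gt \<psi>] by blast
  have "A y = (\<kappa> / \<alpha>) *\<^sub>C y"
  proof (rule dual_separates)
    fix \<phi>' :: "'v \<Rightarrow> complex" assume \<phi>': "bounded_clinear \<phi>'"
    show "\<phi>' (A y) = \<phi>' ((\<kappa> / \<alpha>) *\<^sub>C y)"
      using y[OF comp[OF \<phi>']] gbeta[OF \<phi>'] y[OF \<phi>'] scaleC[OF \<phi>'] by simp
  qed
  moreover have "y \<noteq> 0"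
    using ne y[OF \<phi>] \<phi> by (auto simp: bounded_clinear_def clinear_0)
  ultimately have "\<alpha> \<in> point_spectrum A" "\<kappa> / \<alpha> \<in> point_spectrum A"
    by (auto simp: point_spectrum_def)
  with alpha0 that show thesis by fastforce
qed

section \<open>Extension of bilinear maps\<close>

lemma sum_append:
  fixes n m :: nat
  shows "(\<Sum>i<n + m. h (if i < n then x i else x' (i - n)) (if i < n then y i else y' (i - n))) =
    (\<Sum>i<n. h (x i) (y i)) + (\<Sum>i<m. h (x' i) (y' i))"
  by (induction m) (simp_all add: add.assoc)

text \<open>The extension is obtained as the closure of the graph; the bound makes it single-valued.\<close>

lemma bilinear_extension:
  fixes \<tau> :: "'x::complex_normed_vector \<Rightarrow> 'x \<Rightarrow> 'c::complex_banach"
    and g :: "'x \<Rightarrow> 'x \<Rightarrow> 'v::complex_banach"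
  assumes \<tau>_scale: "\<And>c x y. \<tau> (c *\<^sub>C x) y = c *\<^sub>C \<tau> x y"
    and g_scale: "\<And>c x y. g (c *\<^sub>C x) y = c *\<^sub>C g x y"
    and bound: "\<And>n x y. norm (\<Sum>i<n::nat. g (x i) (y i)) \<le> K * norm (\<Sum>i<n. \<tau> (x i) (y i))"
    and dense: "closure {\<Sum>i<n::nat. \<tau> (x i) (y i) |n x y. True} = UNIV"
  obtains G where "bounded_clinear G" "\<And>x y. G (\<tau> x y) = g x y"
proof -
  \<comment> \<open>Concatenating families makes R closed under addition; homogeneity in the first
    factor makes it closed under scalars. So it is a subspace of the product.\<close>
  define R where "R = {(\<Sum>i<n::nat. \<tau> (x i) (y i), \<Sum>i<n. g (x i) (y i)) |n x y. True}"
  have R_add: "p + q \<in> R" if pq: "p \<in> R" "q \<in> R" for p q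
  proof -
    obtain n :: nat and x y where p: "p = (\<Sum>i<n. \<tau> (x i) (y i), \<Sum>i<n. g (x i) (y i))"
      using pq(1) unfolding R_def by blast
    obtain m :: nat and x' y' where q: "q = (\<Sum>i<m. \<tau> (x' i) (y' i), \<Sum>i<m. g (x' i) (y' i))"
      using pq(2) unfolding R_def by blast
    show ?thesis
      unfolding R_def p q
      by (intro CollectI exI[of _ "n + m"] exI[of _ "\<lambda>i. if i < n then x i else x' (i - n)"]
          exI[of _ "\<lambda>i. if i < n then y i else y' (i - n)"]) (simp add: sum_append)
  qed
  have R_scale: "(c *\<^sub>C fst p, c *\<^sub>C snd p) \<in> R" if p: "p \<in> R" for p c
  proof -
    obtain n :: nat and x y where p: "p = (\<Sum>i<n. \<tau> (x i) (y i), \<Sum>i<n. g (x i) (y i))"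
      using p unfolding R_def by blast
    show ?thesis
      unfolding R_def p
      by (intro CollectI exI[of _ n] exI[of _ "\<lambda>i. c *\<^sub>C x i"] exI[of _ y])
        (simp add: \<tau>_scale g_scale scaleC_sum_right)
  qed
  have scaleC_lim: "(\<lambda>k. c *\<^sub>C h k) \<longlonglongrightarrow> c *\<^sub>C l" if "h \<longlonglongrightarrow> l"
    for c and h :: "nat \<Rightarrow> 'w::complex_normed_vector" and l
    using bounded_clinear_scaleC[of c] that unfolding bounded_clinear_def
    by (auto intro: bounded_linear.tendsto)
  define Q where "Q = closure R"
  have Q_add: "p + q \<in> Q" if pq: "p \<in> Q" "q \<in> Q" for p q
  proof -
    obtain a b where "\<And>k. a k \<in> R" "a \<longlonglongrightarrow> p" "\<And>k. b k \<in> R" "b \<longlonglongrightarrow> q"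
      using pq unfolding Q_def closure_sequential by blast
    then have "\<And>k. a k + b k \<in> R" "(\<lambda>k. a k + b k) \<longlonglongrightarrow> p + q"
      by (auto intro: R_add tendsto_add)
    then show ?thesis
      unfolding Q_def closure_sequential by (intro exI[of _ "\<lambda>k. a k + b k"]) simp
  qed
  have Q_scale: "(c *\<^sub>C fst p, c *\<^sub>C snd p) \<in> Q" if p: "p \<in> Q" for p c
  proof -
    obtain a where a: "\<And>k. a k \<in> R" "a \<longlonglongrightarrow> p"
      using p unfolding Q_def closure_sequential by blast
    have "(\<lambda>k. (c *\<^sub>C fst (a k), c *\<^sub>C snd (a k))) \<longlonglongrightarrow> (c *\<^sub>C fst p, c *\<^sub>C snd p)"
      by (intro tendsto_Pair scaleC_lim tendsto_fst tendsto_snd a)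
    then show ?thesis
      unfolding Q_def closure_sequential
      by (intro exI[of _ "\<lambda>k. (c *\<^sub>C fst (a k), c *\<^sub>C snd (a k))"]) (simp add: R_scale a)
  qed
  have R_bound: "norm (snd p) \<le> K * norm (fst p)" if "p \<in> R" for p
    using that bound unfolding R_def by auto
  have Q_bound: "norm (snd p) \<le> K * norm (fst p)" if "p \<in> Q" for p
  proof -
    have "closed {p :: 'c \<times> 'v. norm (snd p) \<le> K * norm (fst p)}"
      by (intro closed_Collect_le continuous_intros)
    then have "Q \<subseteq> {p. norm (snd p) \<le> K * norm (fst p)}"
      unfolding Q_def using R_bound by (intro closure_minimal) auto
    with that show ?thesis by blast
  qed
  \<comment> \<open>Kept general in S because it is applied both to R and to its closure Q.\<close>
  have diff: "p - q \<in> S" if "p \<in> S" "q \<in> S"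
    and add: "\<And>p q. p \<in> S \<Longrightarrow> q \<in> S \<Longrightarrow> p + q \<in> S"
    and scale: "\<And>p c. p \<in> S \<Longrightarrow> (c *\<^sub>C fst p, c *\<^sub>C snd p) \<in> S"
    for p q and S :: "('c \<times> 'v) set"
  proof -
    have "p + ((- 1) *\<^sub>C fst q, (- 1) *\<^sub>C snd q) \<in> S"
      using that by blast
    then show ?thesis
      by (simp add: scaleC_minus_1 prod_eq_iff plus_prod_def minus_prod_def)
  qed
  \<comment> \<open>The bound, applied to differences of pairs, turns a convergent sequence of first
    components into a Cauchy sequence of second components, which converges by completeness.\<close>
  have total: "\<exists>v. (z, v) \<in> Q" for z
  proof -
    have "z \<in> closure (fst ` R)"
    proof -
      have "fst ` R = {\<Sum>i<n::nat. \<tau> (x i) (y i) |n x y. True}"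
        unfolding R_def by force
      then show ?thesis using dense by simp
    qed
    then obtain d where d: "\<And>k. d k \<in> fst ` R" "d \<longlonglongrightarrow> z"
      unfolding closure_sequential by blast
    then have "\<forall>k. \<exists>v. (d k, v) \<in> R" by force
    then obtain v where v: "\<And>k. (d k, v k) \<in> R" by metis
    have le: "dist (v k) (v l) \<le> \<bar>K\<bar> * dist (d k) (d l)" for k l
    proof -
      have "(d k, v k) - (d l, v l) \<in> R"
        by (intro diff v R_add R_scale)
      from R_bound[OF this] have "norm (v k - v l) \<le> K * norm (d k - d l)" by simp
      also have "\<dots> \<le> \<bar>K\<bar> * norm (d k - d l)" by (intro mult_right_mono) auto
      finally show ?thesis by (simp add: dist_norm)
    qed
    have "Cauchy d" using d(2) by (rule LIMSEQ_imp_Cauchy)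
    have "Cauchy v"
      unfolding Cauchy_def
    proof (intro allI impI)
      fix e :: real assume e: "e > 0"
      then have "e / (\<bar>K\<bar> + 1) > 0" by simp
      with \<open>Cauchy d\<close> obtain N where N: "\<And>k l. k \<ge> N \<Longrightarrow> l \<ge> N \<Longrightarrow> dist (d k) (d l) < e / (\<bar>K\<bar> + 1)"
        unfolding Cauchy_def by blast
      have "dist (v k) (v l) < e" if "k \<ge> N" "l \<ge> N" for k l
      proof -
        have "dist (v k) (v l) \<le> (\<bar>K\<bar> + 1) * dist (d k) (d l)"
          using le[of k l] by (simp add: distrib_right add_increasing2)
        also have "\<dots> < e"
          using N[OF that] by (simp add: pos_less_divide_eq mult.commute)
        finally show ?thesis .
      qed
      then show "\<exists>N. \<forall>m\<ge>N. \<forall>n\<ge>N. dist (v m) (v n) < e" by blast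
    qed
    then obtain w where "v \<longlonglongrightarrow> w"
      using Cauchy_convergent convergentD by blast
    then have "(\<lambda>k. (d k, v k)) \<longlonglongrightarrow> (z, w)"
      by (intro tendsto_Pair d)
    with v show ?thesis
      unfolding Q_def closure_sequential by (intro exI[of _ w] exI[of _ "\<lambda>k. (d k, v k)"]) simp
  qed
  \<comment> \<open>The choice is no real choice: two values over the same z differ by v with (0, v)
    in Q, and the bound gives v = 0.\<close>
  define G where "G z = (SOME v. (z, v) \<in> Q)" for z
  have G: "(z, G z) \<in> Q" for z
    unfolding G_def using total by (rule someI_ex)
  have G_eq: "G z = v" if "(z, v) \<in> Q" for z v
  proof -
    have "(z, G z) - (z, v) \<in> Q"
      by (intro diff G that Q_add Q_scale)
    from Q_bound[OF this] show ?thesis by simp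
  qed
  have "bounded_clinear G"
  proof (rule bounded_clinearI[where K = K])
    show "G (z + w) = G z + G w" for z w
      using Q_add[OF G[of z] G[of w]] by (intro G_eq) simp
    show "G (c *\<^sub>C z) = c *\<^sub>C G z" for c z
      using Q_scale[OF G[of z]] by (intro G_eq) simp
    show "norm (G z) \<le> K * norm z" for z
      using Q_bound[OF G[of z]] by simp
  qed
  moreover have "G (\<tau> x y) = g x y" for x y
  proof (rule G_eq)
    have "(\<tau> x y, g x y) \<in> R"
      unfolding R_def by (intro CollectI exI[of _ 1] exI[of _ "\<lambda>_. x"] exI[of _ "\<lambda>_. y"]) simp
    then show "(\<tau> x y, g x y) \<in> Q"
      unfolding Q_def using closure_subset by blast
  qed
  ultimately show thesis by (rule that)
qed

lemma bounded_clinear_eqI: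
  fixes F G :: "'c::complex_normed_vector \<Rightarrow> 'v::complex_normed_vector"
  assumes F: "bounded_clinear F" and G: "bounded_clinear G"
    and eq: "\<And>x y. F (\<tau> x y) = G (\<tau> x y)"
    and dense: "closure {\<Sum>i<n::nat. \<tau> (x i) (y i) |n x y. True} = UNIV"
  shows "F z = G z"
proof -
  have "closed {z. F z = G z}"
    using F G unfolding bounded_clinear_def
    by (intro closed_Collect_eq) (auto intro: linear_continuous_on)
  moreover have "{\<Sum>i<n::nat. \<tau> (x i) (y i) |n x y. True} \<subseteq> {z. F z = G z}"
    using F G eq unfolding bounded_clinear_def by (auto simp: clinear_sum)
  ultimately have "UNIV \<subseteq> {z. F z = G z}"
    unfolding dense[symmetric] by (intro closure_minimal)
  then show ?thesis by blast
qed

section \<open>Majorants in Banach ideal spaces\<close>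

context banach_ideal_space
begin

lemma rep_0: "AE s in M. rep 0 s = 0"
  using rep_scaleC[of 0 0] by simp

lemma rep_scaleR: "AE s in M. rep (r *\<^sub>R x) s = r * rep x s"
  using rep_scaleC[of "complex_of_real r" x] by (simp add: scaleC_of_real)

lemma rep_diff: "AE s in M. rep (x - y) s = rep x s - rep y s"
  using rep_add[of "x - y" y] by eventually_elim simp

lemma rep_sum_scaleC: "AE s in M. rep (\<Sum>i<n::nat. c i *\<^sub>C x i) s = (\<Sum>i<n. c i * rep (x i) s)"
proof (induction n)
  case 0
  show ?case using rep_0 by simp
next
  case (Suc n)
  then show ?case
    using rep_add[of "\<Sum>i<n. c i *\<^sub>C x i" "c n *\<^sub>C x n"] rep_scaleC[of "c n" "x n"]
    by eventually_elim simp
qed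

lemma norm_mono:
  assumes "AE s in M. cmod (rep y s) \<le> cmod (rep x s)"
  shows "norm y \<le> norm x"
proof -
  obtain y' where y': "AE s in M. rep y' s = rep y s" "norm y' \<le> norm x"
    using ideal[OF rep_measurable assms] by blast
  have "y' = y" by (rule rep_inject[OF y'(1)])
  with y'(2) show ?thesis by simp
qed

text \<open>By the order on \<open>complex\<close>, the majorant u is real and nonnegative almost
  everywhere.\<close>

definition maj :: "'x \<Rightarrow> 'x \<Rightarrow> bool" where
  "maj u x \<longleftrightarrow> (AE s in M. complex_of_real (cmod (rep x s)) \<le> rep u s)"

lemma maj_norm: "maj u x \<Longrightarrow> norm x \<le> norm u"
  unfolding maj_def less_eq_complex_def
  by (rule norm_mono) (auto intro: order_trans[OF _ complex_Re_le_cmod])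

lemma maj_self: obtains u where "maj u x" "norm u \<le> norm x"
proof -
  have "(\<lambda>s. complex_of_real (cmod (rep x s))) \<in> borel_measurable M"
    using rep_measurable[of x] by measurable
  from ideal[OF this, of x] obtain u
    where "AE s in M. rep u s = complex_of_real (cmod (rep x s))" "norm u \<le> norm x"
    by auto
  then show thesis
    by (intro that[of u]) (auto simp: maj_def)
qed

lemma maj_0: "maj 0 0"
  unfolding maj_def using rep_0 by eventually_elim simp

lemma maj_add:
  assumes "maj u x" "maj v y"
  shows "maj (u + v) (x + y)"
  using assms rep_add[of u v] rep_add[of x y] unfolding maj_def
proof eventually_elim
  case (elim s)
  then show ?case
    using norm_triangle_ineq[of "rep x s" "rep y s"] by (simp add: less_eq_complex_def)
qed

lemma maj_scale:
  assumes "maj u x" "cmod c \<le> r"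
  shows "maj (r *\<^sub>R u) (c *\<^sub>C x)"
  using assms(1) rep_scaleR[of r u] rep_scaleC[of c x] unfolding maj_def
proof eventually_elim
  case (elim s)
  then have "cmod (rep x s) \<le> Re (rep u s)" by (simp add: less_eq_complex_def)
  then have "cmod c * cmod (rep x s) \<le> r * Re (rep u s)"
    using assms(2) by (intro mult_mono) (auto intro: order_trans[OF norm_ge_zero])
  with elim show ?case by (simp add: less_eq_complex_def norm_mult)
qed

lemma maj_sum:
  assumes "\<And>i. i < n \<Longrightarrow> maj (u i) (x i)"
  shows "maj (\<Sum>i<n::nat. u i) (\<Sum>i<n. x i)"
  using assms by (induction n) (auto simp: maj_0 intro!: maj_add)

text \<open>Norm convergence gives no pointwise convergence, so the defect of the limit inequality
  is itself treated as an element of the space. The function f vanishes exactly where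
  \<open>rep w\<close> is real and at least the modulus of \<open>rep y\<close>; it is dominated by
  elements of arbitrarily small norm, hence represents 0.\<close>

lemma maj_limit:
  assumes maj: "\<And>k. maj (v k) (x k)" and v: "v \<longlonglongrightarrow> w" and x: "x \<longlonglongrightarrow> y"
  shows "maj w y"
proof -
  define f where "f s = complex_of_real (max 0 (cmod (rep y s) - Re (rep w s)) + \<bar>Im (rep w s)\<bar>)" for s
  have f_meas: "f \<in> borel_measurable M"
    unfolding f_def using rep_measurable[of y] rep_measurable[of w] by measurable
  have "\<exists>b. norm b \<le> norm (y - x k) + 2 * norm (w - v k) \<and> (AE s in M. cmod (f s) \<le> cmod (rep b s))" for k
  proof -
    obtain p where p: "maj p (y - x k)" "norm p \<le> norm (y - x k)" by (rule maj_self)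
    obtain q where q: "maj q (w - v k)" "norm q \<le> norm (w - v k)" by (rule maj_self)
    \<comment> \<open>Since v k is real, q bounds both |Re w - Re (v k)| and |Im w|. This accounts
      for the factor 2, while p bounds the change from x k to y.\<close>
    have "AE s in M. cmod (f s) \<le> cmod (rep (p + 2 *\<^sub>R q) s)"
      using p(1) q(1) maj[of k] rep_add[of p "2 *\<^sub>R q"] rep_scaleR[of 2 q] rep_diff[of y "x k"]
        rep_diff[of w "v k"]
      unfolding maj_def
    proof eventually_elim
      case (elim s)
      have "cmod (rep y s) \<le> cmod (rep y s - rep (x k) s) + cmod (rep (x k) s)"
        using norm_triangle_ineq[of "rep y s - rep (x k) s" "rep (x k) s"] by simp
      moreover have "\<bar>Re (rep w s) - Re (rep (v k) s)\<bar> \<le> cmod (rep w s - rep (v k) s)"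
        "\<bar>Im (rep w s) - Im (rep (v k) s)\<bar> \<le> cmod (rep w s - rep (v k) s)"
        using abs_Re_le_cmod[of "rep w s - rep (v k) s"] abs_Im_le_cmod[of "rep w s - rep (v k) s"]
        by simp_all
      moreover have "0 \<le> Re (rep p s)" "0 \<le> Re (rep q s)"
        using elim order_trans[OF norm_ge_zero] by (auto simp: less_eq_complex_def)
      ultimately have "max 0 (cmod (rep y s) - Re (rep w s)) + \<bar>Im (rep w s)\<bar>
          \<le> Re (rep p s) + 2 * Re (rep q s)"
        using elim by (auto simp: less_eq_complex_def max_def)
      also have "\<dots> \<le> cmod (rep (p + 2 *\<^sub>R q) s)"
        using elim complex_Re_le_cmod[of "rep (p + 2 *\<^sub>R q) s"] by simp
      finally show ?case
        unfolding f_def norm_of_real by simp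
    qed
    moreover have "norm (p + 2 *\<^sub>R q) \<le> norm (y - x k) + 2 * norm (w - v k)"
      using norm_triangle_ineq[of p "2 *\<^sub>R q"] p(2) q(2) by simp
    ultimately show ?thesis by blast
  qed
  then obtain b where b: "\<And>k. norm (b k) \<le> norm (y - x k) + 2 * norm (w - v k)"
    "\<And>k. AE s in M. cmod (f s) \<le> cmod (rep (b k) s)"
    by metis
  obtain z where z: "AE s in M. rep z s = f s"
    using ideal[OF f_meas b(2)] by blast
  have "norm z \<le> norm (y - x k) + 2 * norm (w - v k)" for k
  proof -
    have "AE s in M. cmod (rep z s) \<le> cmod (rep (b k) s)"
      using z b(2)[of k] by eventually_elim simp
    from norm_mono[OF this] b(1)[of k] show ?thesis by simp
  qed
  moreover have "(\<lambda>k. norm (y - x k) + 2 * norm (w - v k)) \<longlonglongrightarrow> norm (y - y) + 2 * norm (w - w)"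
    by (intro tendsto_intros v x)
  ultimately have "norm z \<le> 0"
    by (intro LIMSEQ_le_const[where X = "\<lambda>k. norm (y - x k) + 2 * norm (w - v k)"]) auto
  then have "z = 0" by simp
  from z rep_0 show ?thesis
    unfolding maj_def \<open>z = 0\<close>
  proof eventually_elim
    case (elim s)
    then have "max 0 (cmod (rep y s) - Re (rep w s)) + \<bar>Im (rep w s)\<bar> = 0"
      unfolding f_def by (metis of_real_eq_0_iff)
    then show ?case by (auto simp: less_eq_complex_def max_def split: if_splits)
  qed
qed

text \<open>For real p with |p| \<le> u, nonnegativity at u - p and u + p gives |A p| \<le> A u. The
  factor 2 comes from applying this separately to the real and imaginary part of x; any finite
  constant serves the purpose, which is continuity of A \<otimes> A.\<close>

lemma maj_nonneg_operator:
  assumes A: "clinear A" "nonneg_operator M rep A" and u: "maj u x"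
  shows "maj (2 *\<^sub>R A u) (A x)"
proof -
  have real: "AE s in M. cmod (rep (A p) s) \<le> Re (rep (A u) s) \<and> Im (rep (A u) s) = 0"
    if p: "AE s in M. Im (rep p s) = 0 \<and> cmod (rep p s) \<le> cmod (rep x s)" for p
  proof -
    have "AE s in M. 0 \<le> rep (u - p) s"
      using p u rep_diff[of u p] unfolding maj_def
    proof eventually_elim
      case (elim s)
      then show ?case
        using complex_Re_le_cmod[of "rep p s"] by (auto simp: less_eq_complex_def)
    qed
    moreover have "AE s in M. 0 \<le> rep (u + p) s"
      using p u rep_add[of u p] unfolding maj_def
    proof eventually_elim
      case (elim s)
      then show ?case
        using abs_Re_le_cmod[of "rep p s"] by (auto simp: less_eq_complex_def)
    qed
    ultimately have "AE s in M. 0 \<le> rep (A (u - p)) s" "AE s in M. 0 \<le> rep (A (u + p)) s"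
      using A(2) unfolding nonneg_operator_def by blast+
    then show ?thesis
      using rep_diff[of "A u" "A p"] rep_add[of "A u" "A p"]
      unfolding clinear_diff[OF A(1)] clinear_add[OF A(1)]
    proof eventually_elim
      case (elim s)
      then have "Im (rep (A p) s) = 0" "\<bar>Re (rep (A p) s)\<bar> \<le> Re (rep (A u) s)"
        "Im (rep (A u) s) = 0"
        by (auto simp: less_eq_complex_def)
      then show ?case by (simp add: cmod_def)
    qed
  qed
  have "(\<lambda>s. complex_of_real (Re (rep x s))) \<in> borel_measurable M"
    "(\<lambda>s. complex_of_real (Im (rep x s))) \<in> borel_measurable M"
    using rep_measurable[of x] by measurable
  from this[THEN ideal, of x] obtain p q where
    p: "AE s in M. rep p s = complex_of_real (Re (rep x s))" and
    q: "AE s in M. rep q s = complex_of_real (Im (rep x s))"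
    by (auto simp: abs_Re_le_cmod abs_Im_le_cmod)
  have "x = p + \<i> *\<^sub>C q"
  proof (rule rep_inject)
    show "AE s in M. rep x s = rep (p + \<i> *\<^sub>C q) s"
      using p q rep_add[of p "\<i> *\<^sub>C q"] rep_scaleC[of \<i> q]
      by eventually_elim (simp add: complex_eq_iff)
  qed
  then have Ax: "A x = A p + \<i> *\<^sub>C A q"
    by (simp add: clinear_add[OF A(1)] clinear_scaleC[OF A(1)])
  have p': "AE s in M. Im (rep p s) = 0 \<and> cmod (rep p s) \<le> cmod (rep x s)"
    using p by eventually_elim (simp add: abs_Re_le_cmod)
  have q': "AE s in M. Im (rep q s) = 0 \<and> cmod (rep q s) \<le> cmod (rep x s)"
    using q by eventually_elim (simp add: abs_Im_le_cmod)
  show ?thesis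
    unfolding maj_def Ax
    using real[OF p'] real[OF q'] rep_add[of "A p" "\<i> *\<^sub>C A q"] rep_scaleC[of \<i> "A q"]
      rep_scaleR[of 2 "A u"]
  proof eventually_elim
    case (elim s)
    then have "cmod (rep (A p + \<i> *\<^sub>C A q) s) \<le> cmod (rep (A p) s) + cmod (rep (A q) s)"
      using norm_triangle_ineq[of "rep (A p) s" "\<i> * rep (A q) s"] by (simp add: norm_mult)
    with elim show ?case by (simp add: less_eq_complex_def)
  qed
qed

end

section \<open>The L-complete tensor square\<close>

context banach_ideal_space
begin

lemma AE_pair_fst:
  assumes "AE s in M. P s"
  shows "AE p in M \<Otimes>\<^sub>M M. P (fst p)"
proof -
  obtain N where N: "N \<in> null_sets M" "{s \<in> space M. \<not> P s} \<subseteq> N"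
    using assms by (auto simp: eventually_ae_filter)
  then have "N \<times> space M \<in> null_sets (M \<Otimes>\<^sub>M M)"
    by (auto simp: null_sets_def emeasure_pair_measure_Times)
  then show ?thesis
    by (rule AE_I') (use N(2) in \<open>auto simp: space_pair_measure\<close>)
qed

lemma AE_pair_snd:
  assumes "AE s in M. P s"
  shows "AE p in M \<Otimes>\<^sub>M M. P (snd p)"
proof -
  obtain N where N: "N \<in> null_sets M" "{s \<in> space M. \<not> P s} \<subseteq> N"
    using assms by (auto simp: eventually_ae_filter)
  then have "space M \<times> N \<in> null_sets (M \<Otimes>\<^sub>M M)"
    by (auto simp: null_sets_def emeasure_pair_measure_Times)
  then show ?thesis
    by (rule AE_I') (use N(2) in \<open>auto simp: space_pair_measure\<close>)
qed

text \<open>Induction on the number of terms: if \<open>x n \<noteq> 0\<close>, then fixing a point where it does not vanish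
  expresses \<open>y n\<close> by the other \<open>y i\<close>.\<close>

lemma balanced_sum_eq_0:
  fixes f :: "'x \<Rightarrow> 'x \<Rightarrow> 'v::ab_group_add"
  assumes add_left: "\<And>x x' y. f (x + x') y = f x y + f x' y"
    and add_right: "\<And>x y y'. f x (y + y') = f x y + f x y'"
    and balanced: "\<And>c x y. f (c *\<^sub>C x) y = f x (c *\<^sub>C y)"
    and zero: "AE p in M \<Otimes>\<^sub>M M. degenerate rep n x y p = 0"
  shows "(\<Sum>i<n. f (x i) (y i)) = 0"
  using zero
proof (induction n arbitrary: x y)
  case (Suc n)
  interpret pair_sigma_finite M M ..
  have f0: "f 0 v = 0" "f v 0 = 0" for v
    using add_left[of 0 0 v] add_right[of v 0 0] by simp_all
  have f_sum: "f v (\<Sum>i<m. h i) = (\<Sum>i<m. f v (h i))" for v h and m :: nat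
    by (induction m) (simp_all add: f0 add_right)
  show ?case
  proof (cases "x n = 0")
    case True
    have "AE p in M \<Otimes>\<^sub>M M. degenerate rep n x y p = 0"
      using Suc.prems AE_pair_fst[OF rep_0]
      by eventually_elim (auto simp: degenerate_def True split_beta)
    then show ?thesis
      using Suc.IH by (simp add: True f0)
  next
    case False
    \<comment> \<open>Fubini freezes the first variable: for almost every s, the vanishing function
      of t becomes a linear relation among the vectors y i.\<close>
    have "AE s in M. AE t in M. degenerate rep (Suc n) x y (s, t) = 0"
      using Suc.prems by (rule AE_pair)
    then have rel: "AE s in M. (\<Sum>i<Suc n. rep (x i) s *\<^sub>C y i) = 0"
    proof eventually_elim
      case (elim s)
      then have "AE t in M. rep (\<Sum>i<Suc n. rep (x i) s *\<^sub>C y i) t = rep 0 t"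
        using rep_sum_scaleC[of "\<lambda>i. rep (x i) s" y "Suc n"] rep_0
        by eventually_elim (simp add: degenerate_def)
      then show ?case by (rule rep_inject)
    qed
    have "\<exists>s. rep (x n) s \<noteq> 0 \<and> (\<Sum>i<Suc n. rep (x i) s *\<^sub>C y i) = 0"
    proof (rule ccontr)
      assume none: "\<nexists>s. rep (x n) s \<noteq> 0 \<and> (\<Sum>i<Suc n. rep (x i) s *\<^sub>C y i) = 0"
      have "AE s in M. rep (x n) s = rep 0 s"
        using rel rep_0
      proof eventually_elim
        case (elim s)
        then have "rep (x n) s = 0" using none by blast
        with elim show ?case by simp
      qed
      with False show False using rep_inject by blast
    qed
    then obtain s where s: "rep (x n) s \<noteq> 0" "(\<Sum>i<Suc n. rep (x i) s *\<^sub>C y i) = 0" by blast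
    define c where "c i = - rep (x i) s / rep (x n) s" for i
    have "y n = (1 / rep (x n) s) *\<^sub>C (rep (x n) s *\<^sub>C y n)"
      using s(1) by (simp add: scaleC_scaleC)
    also have "rep (x n) s *\<^sub>C y n = (- 1) *\<^sub>C (\<Sum>i<n. rep (x i) s *\<^sub>C y i)"
      using s(2) by (simp add: scaleC_minus_1 eq_neg_iff_add_eq_0 add.commute)
    finally have yn: "y n = (\<Sum>i<n. c i *\<^sub>C y i)"
      by (simp add: scaleC_sum_right scaleC_scaleC c_def)
    \<comment> \<open>Substituting the expression for y n distributes the last product over the
      others: x i becomes x i + c i x n, and n terms remain for the induction hypothesis.\<close>
    have "AE p in M \<Otimes>\<^sub>M M. \<forall>i\<in>{..<n}. rep (x i + c i *\<^sub>C x n) (fst p) =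
        rep (x i) (fst p) + c i * rep (x n) (fst p)"
    proof (intro AE_finite_allI finite_lessThan AE_pair_fst)
      show "AE s in M. rep (x i + c i *\<^sub>C x n) s = rep (x i) s + c i * rep (x n) s" for i
        using rep_add[of "x i" "c i *\<^sub>C x n"] rep_scaleC[of "c i" "x n"] by eventually_elim simp
    qed
    then have "AE p in M \<Otimes>\<^sub>M M. degenerate rep n (\<lambda>i. x i + c i *\<^sub>C x n) y p = 0"
      using AE_pair_snd[OF rep_sum_scaleC[of c y n]] Suc.prems
    proof eventually_elim
      case (elim p)
      then have "degenerate rep n (\<lambda>i. x i + c i *\<^sub>C x n) y p =
          (\<Sum>i<n. rep (x i) (fst p) * rep (y i) (snd p)) +
          rep (x n) (fst p) * (\<Sum>i<n. c i * rep (y i) (snd p))"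
        by (simp add: degenerate_def split_beta sum.distrib sum_distrib_left algebra_simps)
      with elim show ?case
        by (simp add: degenerate_def split_beta yn)
    qed
    then have "(\<Sum>i<n. f (x i + c i *\<^sub>C x n) (y i)) = 0"
      by (rule Suc.IH)
    then show ?thesis
      by (simp add: add_left balanced sum.distrib yn f_sum)
  qed
qed simp

lemma degenerate_append:
  "degenerate rep (n + m) (\<lambda>i. if i < n then x i else x' (i - n)) (\<lambda>i. if i < n then y i else y' (i - n)) p =
    degenerate rep n x y p + degenerate rep m x' y' p"
  using sum_append[of "\<lambda>a b. rep a (fst p) * rep b (snd p)"]
  by (simp add: degenerate_def split_beta)

lemma degenerate_scale:
  "AE p in M \<Otimes>\<^sub>M M. degenerate rep n (\<lambda>i. c *\<^sub>C x i) y p = c * degenerate rep n x y p"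
proof -
  have "AE p in M \<Otimes>\<^sub>M M. \<forall>i\<in>{..<n}. rep (c *\<^sub>C x i) (fst p) = c * rep (x i) (fst p)"
    by (intro AE_finite_allI finite_lessThan AE_pair_fst rep_scaleC)
  then show ?thesis
    by eventually_elim (simp add: degenerate_def split_beta sum_distrib_left mult.assoc)
qed

text \<open>Makes balanced biadditive maps, such as the one taking x and y to
  \<open>\<phi> y *\<^sub>C x\<close>, well defined on classes of degenerate functions. Two
  representations are subtracted by concatenating one with the negative of the other.\<close>

lemma balanced_sum_cong:
  fixes f :: "'x \<Rightarrow> 'x \<Rightarrow> 'v::ab_group_add"
  assumes add_left: "\<And>x x' y. f (x + x') y = f x y + f x' y"
    and add_right: "\<And>x y y'. f x (y + y') = f x y + f x y'"
    and balanced: "\<And>c x y. f (c *\<^sub>C x) y = f x (c *\<^sub>C y)"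
    and eq: "AE p in M \<Otimes>\<^sub>M M. degenerate rep n x y p = degenerate rep m x' y' p"
  shows "(\<Sum>i<n. f (x i) (y i)) = (\<Sum>i<m. f (x' i) (y' i))"
proof -
  have f0: "f 0 v = 0" for v
    using add_left[of 0 0 v] by simp
  have f_minus: "f ((- 1) *\<^sub>C u) v = - f u v" for u v
    using add_left[of "- u" u v] by (simp add: scaleC_minus_1 f0 eq_neg_iff_add_eq_0)
  have "AE p in M \<Otimes>\<^sub>M M. degenerate rep (n + m) (\<lambda>i. if i < n then x i else (- 1) *\<^sub>C x' (i - n))
      (\<lambda>i. if i < n then y i else y' (i - n)) p = 0"
    using eq degenerate_scale[of m "- 1" x' y']
    by eventually_elim (simp add: degenerate_append[of n m x "\<lambda>i. (- 1) *\<^sub>C x' i"])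
  from balanced_sum_eq_0[of f, OF add_left add_right balanced this]
  have "(\<Sum>i<n. f (x i) (y i)) + (\<Sum>i<m. f ((- 1) *\<^sub>C x' i) (y' i)) = 0"
    by (simp only: sum_append[where h = f and x' = "\<lambda>i. (- 1) *\<^sub>C x' i"])
  then show ?thesis
    by (simp add: f_minus sum_negf)
qed

lemma degenerate_in_tensor_square: "degenerate rep n x y \<in> tensor_square M rep"
  unfolding tensor_square_def by blast

lemma tensor_square_add:
  assumes "z \<in> tensor_square M rep" "w \<in> tensor_square M rep"
  shows "(\<lambda>p. z p + w p) \<in> tensor_square M rep"
proof -
  obtain n x y m x' y' where
    z: "AE p in M \<Otimes>\<^sub>M M. z p = degenerate rep n x y p" and
    w: "AE p in M \<Otimes>\<^sub>M M. w p = degenerate rep m x' y' p"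
    using assms unfolding tensor_square_def by blast
  have "AE p in M \<Otimes>\<^sub>M M. z p + w p = degenerate rep (n + m)
      (\<lambda>i. if i < n then x i else x' (i - n)) (\<lambda>i. if i < n then y i else y' (i - n)) p"
    using z w by eventually_elim (simp only: degenerate_append)
  then show ?thesis unfolding tensor_square_def by blast
qed

lemma tensor_square_scale:
  assumes "z \<in> tensor_square M rep"
  shows "(\<lambda>p. c * z p) \<in> tensor_square M rep"
proof -
  obtain n x y where z: "AE p in M \<Otimes>\<^sub>M M. z p = degenerate rep n x y p"
    using assms unfolding tensor_square_def by blast
  have "AE p in M \<Otimes>\<^sub>M M. c * z p = degenerate rep n (\<lambda>i. c *\<^sub>C x i) y p"
    using z degenerate_scale[of n c x y] by eventually_elim simp
  then show ?thesis unfolding tensor_square_def by blast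
qed

text \<open>Moves the pointwise condition inside \<open>levin_norm\<close> to vectors of X, where
  the calculus of \<open>maj\<close> applies.\<close>

lemma maj_slice_iff:
  fixes y :: "nat \<Rightarrow> 'x"
  shows "(\<forall>\<phi> :: 'x \<Rightarrow> complex. bounded_clinear \<phi> \<longrightarrow> onorm \<phi> \<le> 1 \<longrightarrow>
      (AE s in M. complex_of_real (cmod (\<Sum>i<n. rep (x i) s * \<phi> (y i))) \<le> rep u s)) \<longleftrightarrow>
    (\<forall>\<phi>\<in>dual_ball 1. maj u (\<Sum>i<n. \<phi> (y i) *\<^sub>C x i))"
proof -
  have "(AE s in M. complex_of_real (cmod (\<Sum>i<n. rep (x i) s * \<phi> (y i))) \<le> rep u s) \<longleftrightarrow>
      maj u (\<Sum>i<n. \<phi> (y i) *\<^sub>C x i)" for \<phi> :: "'x \<Rightarrow> complex"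
    unfolding maj_def
    by (rule eventually_cong[OF rep_sum_scaleC[of "\<lambda>i. \<phi> (y i)" x n]])
      (simp add: mult.commute)
  then show ?thesis
    by (auto simp: dual_ball_1_iff)
qed

end

section \<open>The Levin norm on sums of elementary tensors\<close>

locale levin_square = banach_ideal_space M rep
  for M :: "'a measure" and rep :: "'x::complex_banach \<Rightarrow> 'a \<Rightarrow> complex" +
  fixes \<iota> :: "('a \<times> 'a \<Rightarrow> complex) \<Rightarrow> 'c::complex_banach"
  assumes completion: "levin_completion M rep \<iota>"
begin

lemma
  shows \<iota>_add: "z \<in> tensor_square M rep \<Longrightarrow> w \<in> tensor_square M rep \<Longrightarrow> \<iota> (\<lambda>p. z p + w p) = \<iota> z + \<iota> w"
    and \<iota>_scale: "z \<in> tensor_square M rep \<Longrightarrow> \<iota> (\<lambda>p. c * z p) = c *\<^sub>C \<iota> z"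
    and norm_\<iota>: "z \<in> tensor_square M rep \<Longrightarrow> norm (\<iota> z) = levin_norm M rep z"
    and \<iota>_dense: "closure (\<iota> ` tensor_square M rep) = UNIV"
  using completion unfolding levin_completion_def by blast+

lemma norm_\<iota>_le:
  assumes "AE p in M \<Otimes>\<^sub>M M. z p = degenerate rep n x y p"
    and "\<And>\<phi>. \<phi> \<in> dual_ball 1 \<Longrightarrow> maj u (\<Sum>i<n. \<phi> (y i) *\<^sub>C x i)"
  shows "norm (\<iota> z) \<le> norm u"
proof -
  have z: "z \<in> tensor_square M rep"
    using assms(1) unfolding tensor_square_def by blast
  show ?thesis
    unfolding norm_\<iota>[OF z] levin_norm_def maj_slice_iff
  proof (rule cInf_lower)
    show "norm u \<in> {norm u |u. \<exists>n x y. (AE p in M \<Otimes>\<^sub>M M. z p = degenerate rep n x y p) \<and>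
        (\<forall>\<phi>\<in>dual_ball 1. maj u (\<Sum>i<n. \<phi> (y i) *\<^sub>C x i))}"
      using assms by blast
  qed (auto intro: bdd_belowI[where m = 0])
qed

text \<open>The embedding is defined on functions rather than classes. The difference of z and w is
  represented by the empty sum, which has the majorant 0, so its image has norm 0.\<close>

lemma \<iota>_cong:
  assumes z: "z \<in> tensor_square M rep" and w: "w \<in> tensor_square M rep"
    and eq: "AE p in M \<Otimes>\<^sub>M M. z p = w p"
  shows "\<iota> z = \<iota> w"
proof -
  have "norm (\<iota> (\<lambda>p. z p + (- 1) * w p)) \<le> norm (0 :: 'x)"
    by (rule norm_\<iota>_le[where n = 0 and x = "\<lambda>_. 0" and y = "\<lambda>_. 0"])
      (use eq in \<open>auto simp: degenerate_def split_beta maj_0\<close>)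
  moreover have "\<iota> (\<lambda>p. z p + (- 1) * w p) = \<iota> z + (- 1) *\<^sub>C \<iota> w"
    by (simp only: \<iota>_add \<iota>_scale tensor_square_scale z w)
  ultimately show ?thesis
    by (simp add: scaleC_minus_1)
qed

definition tensor :: "'x \<Rightarrow> 'x \<Rightarrow> 'c" where
  "tensor x y = \<iota> (degenerate rep 1 (\<lambda>_. x) (\<lambda>_. y))"

lemma \<iota>_degenerate: "\<iota> (degenerate rep n x y) = (\<Sum>i<n. tensor (x i) (y i))"
proof (induction n)
  case 0
  have "\<iota> (\<lambda>p. 0 * degenerate rep 0 x y p) = 0 *\<^sub>C \<iota> (degenerate rep 0 x y)"
    by (rule \<iota>_scale[OF degenerate_in_tensor_square])
  then show ?case
    by (simp add: degenerate_def split_beta)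
next
  case (Suc n)
  have "degenerate rep (Suc n) x y =
      (\<lambda>p. degenerate rep n x y p + degenerate rep 1 (\<lambda>_. x n) (\<lambda>_. y n) p)"
    by (auto simp: degenerate_def)
  then show ?case
    using Suc \<iota>_add[OF degenerate_in_tensor_square degenerate_in_tensor_square]
    by (simp add: tensor_def)
qed

lemma tensor_dense: "closure {\<Sum>i<n::nat. tensor (x i) (y i) |n x y. True} = UNIV"
proof -
  have "\<iota> ` tensor_square M rep \<subseteq> {\<Sum>i<n::nat. tensor (x i) (y i) |n x y. True}"
  proof
    fix v assume "v \<in> \<iota> ` tensor_square M rep"
    then obtain z where z: "z \<in> tensor_square M rep" "v = \<iota> z" by blast
    then obtain n x y where "AE p in M \<Otimes>\<^sub>M M. z p = degenerate rep n x y p"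
      unfolding tensor_square_def by blast
    then have "v = \<iota> (degenerate rep n x y)"
      unfolding z(2) by (intro \<iota>_cong z degenerate_in_tensor_square)
    then show "v \<in> {\<Sum>i<n::nat. tensor (x i) (y i) |n x y. True}"
      unfolding \<iota>_degenerate by blast
  qed
  from closure_mono[OF this] show ?thesis
    unfolding \<iota>_dense by blast
qed

lemma tensor_scale_left: "tensor (c *\<^sub>C x) y = c *\<^sub>C tensor x y"
proof -
  have "tensor (c *\<^sub>C x) y = \<iota> (\<lambda>p. c * degenerate rep 1 (\<lambda>_. x) (\<lambda>_. y) p)"
    unfolding tensor_def
    by (intro \<iota>_cong tensor_square_scale degenerate_in_tensor_square degenerate_scale)
  then show ?thesis
    by (simp add: \<iota>_scale degenerate_in_tensor_square tensor_def)
qed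

lemma tensor_scale_right: "tensor x (c *\<^sub>C y) = c *\<^sub>C tensor x y"
proof -
  have "AE p in M \<Otimes>\<^sub>M M. degenerate rep 1 (\<lambda>_. x) (\<lambda>_. c *\<^sub>C y) p = c * degenerate rep 1 (\<lambda>_. x) (\<lambda>_. y) p"
    using AE_pair_snd[OF rep_scaleC[of c y]]
    by eventually_elim (simp add: degenerate_def split_beta)
  then have "tensor x (c *\<^sub>C y) = \<iota> (\<lambda>p. c * degenerate rep 1 (\<lambda>_. x) (\<lambda>_. y) p)"
    unfolding tensor_def by (intro \<iota>_cong tensor_square_scale degenerate_in_tensor_square)
  then show ?thesis
    by (simp add: \<iota>_scale degenerate_in_tensor_square tensor_def)
qed

lemma norm_tensor_le:
  assumes "\<And>\<phi>. \<phi> \<in> dual_ball 1 \<Longrightarrow> maj u (\<Sum>i<n::nat. \<phi> (y i) *\<^sub>C x i)"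
  shows "norm (\<Sum>i<n. tensor (x i) (y i)) \<le> norm u"
  unfolding \<iota>_degenerate[symmetric] using assms by (intro norm_\<iota>_le) auto

text \<open>The infimum in the Levin norm allows a different representation for each u. The slices
  do not depend on it by \<open>balanced_sum_cong\<close>, so a nearly optimal u also majorizes the
  slices of the given representation.\<close>

lemma tensor_majorant:
  fixes n :: nat
  assumes e: "e > 0"
  obtains u where "norm u < norm (\<Sum>i<n. tensor (x i) (y i)) + e"
    "\<And>\<phi>. \<phi> \<in> dual_ball 1 \<Longrightarrow> maj u (\<Sum>i<n. \<phi> (y i) *\<^sub>C x i)"
proof -
  define U where "U = {norm u |u. \<exists>m x' y'.
     (AE p in M \<Otimes>\<^sub>M M. degenerate rep n x y p = degenerate rep m x' y' p) \<and>
     (\<forall>\<phi>\<in>dual_ball 1. maj u (\<Sum>i<m. \<phi> (y' i) *\<^sub>C x' i))}"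
  have "\<exists>u. maj u x" for x
    using maj_self by blast
  then obtain v where v: "\<And>x. maj (v x) x" by metis
  \<comment> \<open>A crude majorant, from |\<phi> (y i)| \<le> norm (y i): it shows that the set of
    norms is nonempty, so that its infimum can be approached.\<close>
  have "maj (\<Sum>i<n. norm (y i) *\<^sub>R v (x i)) (\<Sum>i<n. \<phi> (y i) *\<^sub>C x i)" if "\<phi> \<in> dual_ball 1" for \<phi>
    using that by (intro maj_sum maj_scale v) (auto simp: dual_ball_def)
  then have "norm (\<Sum>i<n. norm (y i) *\<^sub>R v (x i)) \<in> U"
    unfolding U_def by blast
  then have "U \<noteq> {}" by blast
  moreover have "norm (\<Sum>i<n. tensor (x i) (y i)) = Inf U"
    unfolding \<iota>_degenerate[symmetric] norm_\<iota>[OF degenerate_in_tensor_square] levin_norm_def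
      maj_slice_iff U_def ..
  ultimately obtain r where r: "r \<in> U" "r < norm (\<Sum>i<n. tensor (x i) (y i)) + e"
    using cInf_lessD[of U "norm (\<Sum>i<n. tensor (x i) (y i)) + e"] e by auto
  then obtain u m x' y' where u: "norm u < norm (\<Sum>i<n. tensor (x i) (y i)) + e"
    "AE p in M \<Otimes>\<^sub>M M. degenerate rep n x y p = degenerate rep m x' y' p"
    "\<And>\<phi>. \<phi> \<in> dual_ball 1 \<Longrightarrow> maj u (\<Sum>i<m. \<phi> (y' i) *\<^sub>C x' i)"
    unfolding U_def by blast
  have "maj u (\<Sum>i<n. \<phi> (y i) *\<^sub>C x i)" if \<phi>: "\<phi> \<in> dual_ball 1" for \<phi>
  proof -
    have cl: "clinear \<phi>" using \<phi> by (simp add: dual_ball_def)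
    have "(\<Sum>i<n. \<phi> (y i) *\<^sub>C x i) = (\<Sum>i<m. \<phi> (y' i) *\<^sub>C x' i)"
      by (rule balanced_sum_cong[where f = "\<lambda>x y. \<phi> y *\<^sub>C x", OF _ _ _ u(2)])
        (simp_all add: scaleC_add_right scaleC_add_left scaleC_scaleC clinear_add[OF cl]
          clinear_scaleC[OF cl] scaleC_complex_def mult.commute)
    with u(3)[OF \<phi>] show ?thesis by simp
  qed
  with u(1) that show thesis by blast
qed

text \<open>The continuity estimate under which \<open>bilinear_extension\<close> extends slices to
  the completion. A majorant dominates the slice in norm, and its own norm is as close to the Levin
  norm as desired.\<close>

lemma norm_slice_le:
  fixes n :: nat
  assumes \<phi>: "\<phi> \<in> dual_ball c" "c > 0"
  shows "norm (\<Sum>i<n. \<phi> (y i) *\<^sub>C x i) \<le> c * norm (\<Sum>i<n. tensor (x i) (y i))"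
proof -
  let ?\<phi> = "\<lambda>x. complex_of_real (1 / c) * \<phi> x"
  have "norm (\<Sum>i<n. ?\<phi> (y i) *\<^sub>C x i) \<le> norm (\<Sum>i<n. tensor (x i) (y i))"
  proof (rule field_le_epsilon)
    fix e :: real assume e: "e > 0"
    obtain u where u: "norm u < norm (\<Sum>i<n. tensor (x i) (y i)) + e"
      "\<And>\<phi>. \<phi> \<in> dual_ball 1 \<Longrightarrow> maj u (\<Sum>i<n. \<phi> (y i) *\<^sub>C x i)"
      using tensor_majorant[OF e, where n = n and x = x and y = y] by blast
    from maj_norm[OF u(2)[OF dual_ball_normalize[OF \<phi>]]] u(1)
    show "norm (\<Sum>i<n. ?\<phi> (y i) *\<^sub>C x i) \<le> norm (\<Sum>i<n. tensor (x i) (y i)) + e" by simp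
  qed
  moreover have "(\<Sum>i<n. ?\<phi> (y i) *\<^sub>C x i) = complex_of_real (1 / c) *\<^sub>C (\<Sum>i<n. \<phi> (y i) *\<^sub>C x i)"
    by (simp only: scaleC_sum_right scaleC_scaleC)
  ultimately show ?thesis
    using \<phi>(2) by (simp add: norm_scaleC norm_divide pos_divide_le_eq mult.commute)
qed

text \<open>Majorants say nothing directly about slices in the second variable. A norming functional
  \<phi> for such a slice exchanges the roles: \<phi> of the slice by \<psi> equals \<psi> of the
  slice by \<phi>, to which the previous estimate applies.\<close>

lemma norm_slice_right_le:
  fixes n :: nat
  assumes \<psi>: "\<psi> \<in> dual_ball c" "c > 0"
  shows "norm (\<Sum>i<n. \<psi> (x i) *\<^sub>C y i) \<le> c * norm (\<Sum>i<n. tensor (x i) (y i))"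
proof -
  let ?w = "\<Sum>i<n. \<psi> (x i) *\<^sub>C y i"
  obtain \<phi> where \<phi>: "\<phi> \<in> dual_ball 1" "\<phi> ?w = norm ?w"
    by (rule norming_functional)
  have cl: "clinear \<phi>" "clinear \<psi>"
    using \<phi> \<psi> by (auto simp: dual_ball_def)
  have "\<phi> ?w = \<psi> (\<Sum>i<n. \<phi> (y i) *\<^sub>C x i)"
    by (simp add: clinear_sum cl clinear_scaleC scaleC_complex_def mult.commute)
  with \<phi>(2) have "norm ?w = cmod (\<psi> (\<Sum>i<n. \<phi> (y i) *\<^sub>C x i))"
    by (metis abs_norm_cancel norm_of_real)
  also have "\<dots> \<le> c * norm (\<Sum>i<n. \<phi> (y i) *\<^sub>C x i)"
    using \<psi> by (simp add: dual_ball_def)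
  also have "\<dots> \<le> c * (1 * norm (\<Sum>i<n. tensor (x i) (y i)))"
    using \<psi>(2) by (intro mult_left_mono norm_slice_le \<phi>) auto
  finally show ?thesis by simp
qed

end

section \<open>Slice maps\<close>

context levin_square
begin

lemma slice_left_exists:
  assumes "bounded_clinear \<phi>"
  shows "\<exists>F. bounded_clinear F \<and> (\<forall>x y. F (tensor x y) = \<phi> y *\<^sub>C x)"
proof -
  obtain c where c: "c > 0" "\<phi> \<in> dual_ball c"
    by (rule bounded_clinear_dual_ball[OF assms], rule that)
  show ?thesis
    by (rule bilinear_extension[OF tensor_scale_left _ norm_slice_le[OF c(2,1)] tensor_dense])
      (auto simp: scaleC_scaleC mult.commute)
qed

definition slice :: "('x \<Rightarrow> complex) \<Rightarrow> 'c \<Rightarrow> 'x" where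
  "slice \<phi> = (SOME F. bounded_clinear F \<and> (\<forall>x y. F (tensor x y) = \<phi> y *\<^sub>C x))"

lemma
  assumes "bounded_clinear \<phi>"
  shows bounded_clinear_slice: "bounded_clinear (slice \<phi>)"
    and slice_tensor: "slice \<phi> (tensor x y) = \<phi> y *\<^sub>C x"
  using someI_ex[OF slice_left_exists[OF assms]] unfolding slice_def by blast+

lemma slice_right_exists:
  assumes "bounded_clinear \<psi>"
  obtains G where "bounded_clinear G" "\<And>x y. G (tensor x y) = \<psi> x *\<^sub>C y"
proof -
  obtain c where c: "c > 0" "\<psi> \<in> dual_ball c"
    by (rule bounded_clinear_dual_ball[OF assms], rule that)
  have cl: "clinear \<psi>" using assms by (simp add: bounded_clinear_def)
  show ?thesis
    by (rule bilinear_extension[OF tensor_scale_left _ norm_slice_right_le[OF c(2,1)] tensor_dense])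
      (auto simp: scaleC_scaleC clinear_scaleC[OF cl] scaleC_complex_def intro: that)
qed

section \<open>Slices determine the elements of the completion\<close>

definition tensors :: "'c set" where
  "tensors = {\<Sum>i<n::nat. tensor (x i) (y i) |n x y. True}"

lemma tensors_diff:
  assumes pq: "p \<in> tensors" "q \<in> tensors"
  shows "p - q \<in> tensors"
proof -
  obtain n :: nat and x y where p: "p = (\<Sum>i<n. tensor (x i) (y i))"
    using pq(1) unfolding tensors_def by blast
  obtain m :: nat and x' y' where q: "q = (\<Sum>i<m. tensor (x' i) (y' i))"
    using pq(2) unfolding tensors_def by blast
  have "p - q = p + (\<Sum>i<m. tensor ((- 1) *\<^sub>C x' i) (y' i))"
    unfolding tensor_scale_left by (simp add: q scaleC_minus_1 sum_negf)
  also have "\<dots> = (\<Sum>i<n + m. tensor (if i < n then x i else (- 1) *\<^sub>C x' (i - n))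
      (if i < n then y i else y' (i - n)))"
    unfolding p by (rule sum_append[where x' = "\<lambda>i. (- 1) *\<^sub>C x' i", symmetric])
  finally show ?thesis
    unfolding tensors_def
    by (intro CollectI exI[of _ "n + m"] exI[of _ "\<lambda>i. if i < n then x i else (- 1) *\<^sub>C x' (i - n)"]
        exI[of _ "\<lambda>i. if i < n then y i else y' (i - n)"]) simp
qed

lemma slice_sum:
  fixes n :: nat
  assumes "bounded_clinear \<phi>"
  shows "slice \<phi> (\<Sum>i<n. tensor (x i) (y i)) = (\<Sum>i<n. \<phi> (y i) *\<^sub>C x i)"
  using bounded_clinear_slice[OF assms]
  by (simp add: bounded_clinear_def clinear_sum slice_tensor[OF assms])

lemma tensors_majorant:
  assumes "w \<in> tensors" "e > 0"
  shows "\<exists>u. norm u < norm w + e \<and> (\<forall>\<phi>\<in>dual_ball 1. maj u (slice \<phi> w))"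
proof -
  obtain n :: nat and x y where w: "w = (\<Sum>i<n. tensor (x i) (y i))"
    using assms(1) unfolding tensors_def by blast
  obtain u where "norm u < norm (\<Sum>i<n. tensor (x i) (y i)) + e"
    "\<And>\<phi>. \<phi> \<in> dual_ball 1 \<Longrightarrow> maj u (\<Sum>i<n. \<phi> (y i) *\<^sub>C x i)"
    using tensor_majorant[OF assms(2), where n = n and x = x and y = y] by blast
  then show ?thesis
    unfolding w by (auto simp: slice_sum dual_ball_bounded_clinear)
qed

lemma tensors_approx:
  assumes "e > 0"
  shows "\<exists>d\<in>tensors. norm (z - d) < e"
proof -
  have "z \<in> closure tensors"
    using tensor_dense unfolding tensors_def by simp
  then show ?thesis
    using assms unfolding closure_approachable by (simp add: dist_norm norm_minus_commute)
qed

text \<open>One u has to serve all \<phi>, although each inequality has its own null set. The series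
  of majorants is therefore summed in norm, independently of \<phi>, and \<open>maj_limit\<close> is
  applied to each \<phi> separately.\<close>

lemma slice_majorant:
  assumes z: "norm z < e"
  obtains u where "norm u \<le> 6 * e" "\<And>\<phi>. \<phi> \<in> dual_ball 1 \<Longrightarrow> maj u (slice \<phi> z)"
proof -
  have e: "e > 0" using z norm_ge_zero[of z] by linarith
  \<comment> \<open>The start d 0 = 0 is admissible because norm z < e; with it, the differences w k
    telescope to d m without a remainder.\<close>
  have "\<exists>d\<in>tensors. norm (z - d) < e * (1 / 2) ^ k \<and> (k = 0 \<longrightarrow> d = 0)" for k
  proof (cases "k = 0")
    case True
    have "(\<Sum>i<0::nat. tensor (0 :: 'x) 0) \<in> tensors"
      unfolding tensors_def by (intro CollectI exI[of _ "0 :: nat"] exI[of _ "\<lambda>_. 0"]) simp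
    then show ?thesis using True z by auto
  next
    case False
    then show ?thesis using tensors_approx[of "e * (1 / 2) ^ k" z] e by simp
  qed
  then have "\<forall>k. \<exists>d. d \<in> tensors \<and> norm (z - d) < e * (1 / 2) ^ k \<and> (k = 0 \<longrightarrow> d = 0)"
    by blast
  from choice[OF this] obtain d where d: "\<And>k. d k \<in> tensors" "\<And>k. norm (z - d k) < e * (1 / 2) ^ k" "d 0 = 0"
    by auto
  define w where "w k = d (Suc k) - d k" for k
  have w: "norm (w k) < 2 * e * (1 / 2) ^ k" for k
  proof -
    have "norm (w k) \<le> norm (z - d k) + norm (z - d (Suc k))"
      using norm_triangle_ineq4[of "z - d k" "z - d (Suc k)"] by (simp add: w_def)
    then show ?thesis
      using d(2)[of k] d(2)[of "Suc k"] mult_pos_pos[OF e zero_less_power[of "1 / 2" k]]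
      by (simp only: power_Suc mult.assoc) linarith
  qed
  have "\<forall>k. \<exists>u. norm u < norm (w k) + e * (1 / 2) ^ k \<and> (\<forall>\<phi>\<in>dual_ball 1. maj u (slice \<phi> (w k)))"
    using e by (intro allI tensors_majorant) (simp_all add: w_def tensors_diff d)
  from choice[OF this] obtain u where u: "\<And>k. norm (u k) < norm (w k) + e * (1 / 2) ^ k"
    "\<And>k \<phi>. \<phi> \<in> dual_ball 1 \<Longrightarrow> maj (u k) (slice \<phi> (w k))"
    by auto
  \<comment> \<open>The 3 is the 2 from the bound on w k plus 1 for the slack in the choice of u k;
    the geometric series doubles it to 6.\<close>
  have u_le: "norm (u k) \<le> 3 * e * (1 / 2) ^ k" for k
    using u(1)[of k] w[of k] by simp
  have sums: "(\<lambda>k. 3 * e * (1 / 2) ^ k) sums (6 * e)"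
    using sums_mult[OF geometric_sums[of "1 / 2 :: real"], of "3 * e"] by simp
  have summ: "summable (\<lambda>k. norm (u k))"
    by (rule summable_comparison_test'[OF sums_summable[OF sums], of 0]) (simp add: u_le)
  have "norm (suminf u) \<le> (\<Sum>k. norm (u k))"
    by (rule summable_norm[OF summ])
  also have "\<dots> \<le> (\<Sum>k. 3 * e * (1 / 2) ^ k)"
    by (intro suminf_le u_le summ sums_summable[OF sums])
  also have "\<dots> = 6 * e"
    using sums by (simp add: sums_iff)
  finally have "norm (suminf u) \<le> 6 * e" .
  moreover have "maj (suminf u) (slice \<phi> z)" if \<phi>: "\<phi> \<in> dual_ball 1" for \<phi>
  proof (rule maj_limit)
    note bc = bounded_clinear_slice[OF dual_ball_bounded_clinear[OF \<phi>]]
    show "maj (\<Sum>k<m. u k) (slice \<phi> (d m))" for m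
    proof -
      have "d m = (\<Sum>k<m. w k)"
        by (simp add: w_def sum_lessThan_telescope d(3))
      then have "slice \<phi> (d m) = (\<Sum>k<m. slice \<phi> (w k))"
        using bc by (simp add: bounded_clinear_def clinear_sum)
      then show ?thesis
        using u(2)[OF \<phi>] by (simp add: maj_sum)
    qed
    show "(\<lambda>m. \<Sum>k<m. u k) \<longlonglongrightarrow> suminf u"
      by (rule summable_LIMSEQ[OF summable_norm_cancel[OF summ]])
    have "(\<lambda>m. z - d m) \<longlonglongrightarrow> 0"
    proof (rule Lim_null_comparison)
      show "\<forall>\<^sub>F m in sequentially. norm (z - d m) \<le> e * (1 / 2) ^ m"
        using d(2) by (intro always_eventually allI less_imp_le)
      show "(\<lambda>m. e * (1 / 2) ^ m) \<longlonglongrightarrow> 0"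
        by (intro tendsto_mult_right_zero LIMSEQ_power_zero) simp
    qed
    then have "(\<lambda>m. z - (z - d m)) \<longlonglongrightarrow> z - 0"
      by (intro tendsto_diff tendsto_const)
    then have "d \<longlonglongrightarrow> z" by simp
    then show "(\<lambda>m. slice \<phi> (d m)) \<longlonglongrightarrow> slice \<phi> z"
      using bc by (auto simp: bounded_clinear_def intro: bounded_linear.tendsto)
  qed
  ultimately show thesis by (rule that)
qed

text \<open>If all slices of z vanish, those of an approximation d are the negatives of those of z -
  d and share their small majorant. For d the Levin norm is available and is bounded by that
  majorant. With norm (z - d) < e / 7, the bounds e / 7 and 6 e / 7 add up to e.\<close>

lemma slices_separate:
  assumes "\<And>\<phi>. \<phi> \<in> dual_ball 1 \<Longrightarrow> slice \<phi> z = 0"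
  shows "z = 0"
proof -
  have "norm z \<le> 0 + e" if e: "e > 0" for e
  proof -
    obtain d where d: "d \<in> tensors" "norm (z - d) < e / 7"
      using tensors_approx[of "e / 7" z] e by auto
    obtain u where u: "norm u \<le> 6 * (e / 7)" "\<And>\<phi>. \<phi> \<in> dual_ball 1 \<Longrightarrow> maj u (slice \<phi> (z - d))"
      by (rule slice_majorant[OF d(2)], rule that)
    obtain n :: nat and x y where n: "d = (\<Sum>i<n. tensor (x i) (y i))"
      using d(1) unfolding tensors_def by blast
    have "norm d \<le> norm u"
      unfolding n
    proof (rule norm_tensor_le)
      fix \<phi> :: "'x \<Rightarrow> complex" assume \<phi>: "\<phi> \<in> dual_ball 1"
      note bc = dual_ball_bounded_clinear[OF \<phi>]
      have "slice \<phi> (z - d) = - slice \<phi> d"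
        using bounded_clinear_slice[OF bc] assms[OF \<phi>] by (simp add: bounded_clinear_def clinear_diff)
      then have "slice \<phi> d = (- 1) *\<^sub>C slice \<phi> (z - d)"
        by (simp add: scaleC_minus_1)
      then have "maj (1 *\<^sub>R u) (slice \<phi> d)"
        using maj_scale[OF u(2)[OF \<phi>], of "- 1" 1] by simp
      then show "maj u (\<Sum>i<n. \<phi> (y i) *\<^sub>C x i)"
        unfolding n by (simp add: slice_sum[OF bc])
    qed
    then show ?thesis
      using u(1) d(2) norm_triangle_ineq[of "z - d" d] by simp
  qed
  then have "norm z \<le> 0" by (rule field_le_epsilon)
  then show ?thesis by simp
qed

lemma tensor_nonzero:
  assumes "x \<noteq> 0" "y \<noteq> 0"
  shows "tensor x y \<noteq> 0"
proof
  assume 0: "tensor x y = 0"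
  obtain \<phi> where \<phi>: "\<phi> \<in> dual_ball 1" "\<phi> y = norm y"
    by (rule norming_functional)
  note bc = dual_ball_bounded_clinear[OF \<phi>(1)]
  have "norm y *\<^sub>R x = slice \<phi> 0"
    using slice_tensor[OF bc, of x y] 0 \<phi>(2) by (simp add: scaleC_of_real)
  also have "\<dots> = 0"
    using bounded_clinear_slice[OF bc] by (simp add: bounded_clinear_def clinear_0)
  finally show False using assms by simp
qed

section \<open>The tensor square of an operator\<close>

text \<open>The slice of the image by \<phi> is A applied to the slice of the original by \<phi>
  \<circ> A. One factor a comes from the norm of \<phi> \<circ> A, the other from the norm of A at
  the majorant, and the 2 from \<open>maj_nonneg_operator\<close>.\<close>

lemma tensor_operator_bound:
  fixes n :: nat
  assumes A: "clinear A" "nonneg_operator M rep A" and a: "a > 0" "\<And>x. norm (A x) \<le> a * norm x"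
  shows "norm (\<Sum>i<n. tensor (A (x i)) (A (y i))) \<le> (2 * a * a) * norm (\<Sum>i<n. tensor (x i) (y i))"
    (is "?l \<le> _ * ?r")
proof -
  have "?l \<le> (2 * a * a) * ?r + e" if e: "e > 0" for e
  proof -
    have "e / (2 * a * a) > 0" using e a(1) by simp
    then obtain u where u: "norm u < ?r + e / (2 * a * a)"
      "\<And>\<phi>. \<phi> \<in> dual_ball 1 \<Longrightarrow> maj u (\<Sum>i<n. \<phi> (y i) *\<^sub>C x i)"
      using tensor_majorant[where e = "e / (2 * a * a)" and n = n and x = x and y = y] by blast
    have "?l \<le> norm (2 *\<^sub>R A (a *\<^sub>R u))"
    proof (rule norm_tensor_le)
      fix \<phi> :: "'x \<Rightarrow> complex" assume \<phi>: "\<phi> \<in> dual_ball 1"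
      have le: "cmod (\<phi> (A v)) \<le> a * norm v" for v
        using \<phi> a(2)[of v] by (auto simp: dual_ball_def intro: order_trans)
      have "(\<lambda>v. \<phi> (A v)) \<in> dual_ball a"
        using \<phi> A(1) le by (auto simp: dual_ball_def clinear_iff)
      from u(2)[OF dual_ball_normalize[OF this a(1)]]
      have "maj (a *\<^sub>R u) (complex_of_real a *\<^sub>C (\<Sum>i<n. (complex_of_real (1 / a) * \<phi> (A (y i))) *\<^sub>C x i))"
        using a(1) by (intro maj_scale) simp_all
      also have "complex_of_real a *\<^sub>C (\<Sum>i<n. (complex_of_real (1 / a) * \<phi> (A (y i))) *\<^sub>C x i) =
          (\<Sum>i<n. \<phi> (A (y i)) *\<^sub>C x i)"
        using a(1) by (simp add: scaleC_sum_right scaleC_scaleC)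
      finally have "maj (2 *\<^sub>R A (a *\<^sub>R u)) (A (\<Sum>i<n. \<phi> (A (y i)) *\<^sub>C x i))"
        by (rule maj_nonneg_operator[OF A])
      then show "maj (2 *\<^sub>R A (a *\<^sub>R u)) (\<Sum>i<n. \<phi> (A (y i)) *\<^sub>C A (x i))"
        by (simp add: clinear_sum[OF A(1)] clinear_scaleC[OF A(1)])
    qed
    also have "\<dots> \<le> 2 * (a * (a * norm u))"
      using a(2)[of "a *\<^sub>R u"] a(1) by simp
    also have "\<dots> \<le> (2 * a * a) * (?r + e / (2 * a * a))"
      using u(1) a(1) by simp
    also have "\<dots> = (2 * a * a) * ?r + e"
      using a(1) by (simp add: distrib_left)
    finally show ?thesis .
  qed
  then show ?thesis by (rule field_le_epsilon)
qed

text \<open>The operator is a definite description: the bound above gives existence, the density of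
  sums of elementary tensors gives uniqueness.\<close>

lemma tensor_square_operator:
  assumes A: "compact_operator A" "nonneg_operator M rep A"
  shows "bounded_clinear (tensor_square_operator rep \<iota> A)"
    and "tensor_square_operator rep \<iota> A (tensor x y) = tensor (A x) (A y)"
proof -
  have cl: "clinear A" using A(1) by (simp add: compact_operator_def)
  obtain a where a: "a > 0" "\<And>x. norm (A x) \<le> a * norm x"
    by (rule compact_operator_bounded[OF A(1)], rule that)
  obtain T where T: "bounded_clinear T" "\<And>x y. T (tensor x y) = tensor (A x) (A y)"
    by (rule bilinear_extension[OF tensor_scale_left _ tensor_operator_bound[OF cl A(2) a] tensor_dense])
      (auto simp: tensor_scale_left clinear_scaleC[OF cl] intro: that)
  have "tensor_square_operator rep \<iota> A = T"
    unfolding tensor_square_operator_def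
  proof (rule the_equality)
    show "bounded_clinear T \<and>
      (\<forall>n x y. T (\<iota> (degenerate rep n x y)) = \<iota> (degenerate rep n (A \<circ> x) (A \<circ> y)))"
      using T(1) by (auto simp: \<iota>_degenerate bounded_clinear_def clinear_sum T(2))
    fix T' :: "'c \<Rightarrow> 'c"
    assume T': "bounded_clinear T' \<and>
      (\<forall>n x y. T' (\<iota> (degenerate rep n x y)) = \<iota> (degenerate rep n (A \<circ> x) (A \<circ> y)))"
    have eq: "T' (tensor x y) = T (tensor x y)" for x y
    proof -
      have "T' (\<iota> (degenerate rep 1 (\<lambda>_. x) (\<lambda>_. y))) = \<iota> (degenerate rep 1 (A \<circ> (\<lambda>_. x)) (A \<circ> (\<lambda>_. y)))"
        using T' by blast
      then show ?thesis by (simp add: T(2) \<iota>_degenerate)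
    qed
    show "T' = T"
      by (rule ext) (rule bounded_clinear_eqI[OF conjunct1[OF T'] T(1) eq tensor_dense])
  qed
  with T show "bounded_clinear (tensor_square_operator rep \<iota> A)"
    "tensor_square_operator rep \<iota> A (tensor x y) = tensor (A x) (A y)"
    by simp_all
qed

text \<open>At an elementary tensor both sides are \<open>\<phi> (A y) *\<^sub>C A x\<close>;
  density does the rest. This is what turns an eigenvector of A \<otimes> A into an
  eigenform.\<close>

lemma slice_tensor_square_operator:
  assumes A: "compact_operator A" "nonneg_operator M rep A" and \<phi>: "bounded_clinear \<phi>"
  shows "A (slice (\<lambda>x. \<phi> (A x)) z) = slice \<phi> (tensor_square_operator rep \<iota> A z)"
proof -
  have bA: "bounded_clinear A"
    by (rule compact_operator_bounded_clinear[OF A(1)])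
  note bc = bounded_clinear_compose[OF \<phi> bA]
  show ?thesis
  proof (rule bounded_clinear_eqI[OF _ _ _ tensor_dense, where F = "\<lambda>z. A (slice (\<lambda>x. \<phi> (A x)) z)"])
    show "bounded_clinear (\<lambda>z. A (slice (\<lambda>x. \<phi> (A x)) z))"
      by (rule bounded_clinear_compose[OF bA bounded_clinear_slice[OF bc]])
    show "bounded_clinear (\<lambda>z. slice \<phi> (tensor_square_operator rep \<iota> A z))"
      by (rule bounded_clinear_compose[OF bounded_clinear_slice[OF \<phi>] tensor_square_operator(1)[OF A]])
    show "A (slice (\<lambda>x. \<phi> (A x)) (tensor x y)) = slice \<phi> (tensor_square_operator rep \<iota> A (tensor x y))" for x y
      using bA unfolding slice_tensor[OF bc] tensor_square_operator(2)[OF A] slice_tensor[OF \<phi>]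
      by (simp add: bounded_clinear_def clinear_scaleC)
  qed
qed

text \<open>The left partial form is evaluation at a slice. The right one is evaluation at the slice
  G z in the other variable, since \<psi> (slice \<phi> z) = \<phi> (G z) holds on elementary
  tensors and extends by density. A majorant common to all slices bounds the form on the unit
  balls.\<close>

lemma slice_form:
  "(\<lambda>(\<psi>, \<phi>). if bounded_clinear \<psi> \<and> bounded_clinear \<phi> then \<psi> (slice \<phi> z) else 0) \<in> tensor_forms"
proof -
  have "\<exists>y. \<forall>\<phi>. bounded_clinear \<phi> \<longrightarrow> \<psi> (slice \<phi> z) = \<phi> y" if \<psi>: "bounded_clinear \<psi>" for \<psi>
  proof -
    obtain G where G: "bounded_clinear G" "\<And>x y. G (tensor x y) = \<psi> x *\<^sub>C y"
      by (rule slice_right_exists[OF \<psi>], rule that)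
    have "\<psi> (slice \<phi> z) = \<phi> (G z)" if \<phi>: "bounded_clinear \<phi>" for \<phi>
    proof (rule bounded_clinear_eqI[OF _ _ _ tensor_dense, where F = "\<lambda>z. \<psi> (slice \<phi> z)"])
      show "bounded_clinear (\<lambda>z. \<psi> (slice \<phi> z))"
        by (rule bounded_clinear_compose[OF \<psi> bounded_clinear_slice[OF \<phi>]])
      show "bounded_clinear (\<lambda>z. \<phi> (G z))"
        by (rule bounded_clinear_compose[OF \<phi> G(1)])
      show "\<psi> (slice \<phi> (tensor x y)) = \<phi> (G (tensor x y))" for x y
        using \<psi> \<phi> unfolding slice_tensor[OF \<phi>] G(2)
        by (simp add: bounded_clinear_def clinear_scaleC scaleC_complex_def mult.commute)
    qed
    then show ?thesis by blast
  qed
  moreover have "\<exists>K. \<forall>\<psi>\<in>dual_ball 1. \<forall>\<phi>\<in>dual_ball 1. cmod (\<psi> (slice \<phi> z)) \<le> K"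
  proof -
    obtain u where u: "\<And>\<phi>. \<phi> \<in> dual_ball 1 \<Longrightarrow> maj u (slice \<phi> z)"
      using slice_majorant[of z "norm z + 1"] by auto
    have "cmod (\<psi> (slice \<phi> z)) \<le> norm u" if "\<psi> \<in> dual_ball 1" "\<phi> \<in> dual_ball 1" for \<psi> \<phi>
      using that(1) maj_norm[OF u[OF that(2)]] by (auto simp: dual_ball_def intro: order_trans)
    then show ?thesis by blast
  qed
  ultimately show ?thesis
    unfolding tensor_forms_def by (auto simp: dual_ball_bounded_clinear)
qed

theorem point_spectrum_tensor_square:
  assumes A: "compact_operator A" "nonneg_operator M rep A"
  shows "point_spectrum (tensor_square_operator rep \<iota> A) - {0} =
    {\<alpha> * \<beta> | \<alpha> \<beta>. \<alpha> \<in> point_spectrum A \<and> \<beta> \<in> point_spectrum A} - {0}"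
proof -
  let ?T = "tensor_square_operator rep \<iota> A"
  have "\<exists>\<alpha> \<beta>. \<kappa> = \<alpha> * \<beta> \<and> \<alpha> \<in> point_spectrum A \<and> \<beta> \<in> point_spectrum A"
    if \<kappa>: "\<kappa> \<in> point_spectrum ?T" "\<kappa> \<noteq> 0" for \<kappa>
  proof -
    obtain z where z: "z \<noteq> 0" "?T z = \<kappa> *\<^sub>C z"
      using \<kappa>(1) unfolding point_spectrum_def by blast
    let ?f = "\<lambda>(\<psi>, \<phi>). if bounded_clinear \<psi> \<and> bounded_clinear \<phi> then \<psi> (slice \<phi> z) else (0 :: complex)"
    \<comment> \<open>The form is nonzero because some slice of z is nonzero and a norming
      functional detects it.\<close>
    obtain \<phi> where \<phi>: "\<phi> \<in> dual_ball 1" "slice \<phi> z \<noteq> 0"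
      using slices_separate z(1) by blast
    obtain \<psi> where \<psi>: "\<psi> \<in> dual_ball 1" "\<psi> (slice \<phi> z) = norm (slice \<phi> z)"
      by (rule norming_functional)
    have "?f \<noteq> (\<lambda>_. 0)"
    proof
      assume "?f = (\<lambda>_. 0)"
      from fun_cong[OF this, of "(\<psi>, \<phi>)"] show False
        using \<phi> \<psi> by (simp add: dual_ball_bounded_clinear)
    qed
    moreover have "?f (\<lambda>x. \<psi> (A x), \<lambda>x. \<phi> (A x)) = \<kappa> * ?f (\<psi>, \<phi>)"
      if \<psi>: "bounded_clinear \<psi>" and \<phi>: "bounded_clinear \<phi>" for \<psi> \<phi>
    proof -
      note bA = compact_operator_bounded_clinear[OF A(1)]
      have "\<psi> (A (slice (\<lambda>x. \<phi> (A x)) z)) = \<kappa> * \<psi> (slice \<phi> z)"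
        unfolding slice_tensor_square_operator[OF A \<phi>] z(2)
        using bounded_clinear_slice[OF \<phi>] \<psi> by (simp add: bounded_clinear_def clinear_scaleC scaleC_complex_def)
      then show ?thesis
        using \<psi> \<phi> by (simp add: bounded_clinear_compose[OF _ bA])
    qed
    ultimately obtain \<alpha> \<beta> where "\<alpha> \<in> point_spectrum A" "\<beta> \<in> point_spectrum A" "\<kappa> = \<alpha> * \<beta>"
      by (rule eigenform_eigenvalues[OF A(1) \<kappa>(2) slice_form])
    then show ?thesis by blast
  qed
  moreover have "\<alpha> * \<beta> \<in> point_spectrum ?T"
    if ab: "\<alpha> \<in> point_spectrum A" "\<beta> \<in> point_spectrum A" for \<alpha> \<beta>
  proof -
    obtain x y where x: "x \<noteq> 0" "A x = \<alpha> *\<^sub>C x" and y: "y \<noteq> 0" "A y = \<beta> *\<^sub>C y"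
      using ab unfolding point_spectrum_def by blast
    have "?T (tensor x y) = (\<alpha> * \<beta>) *\<^sub>C tensor x y"
      unfolding tensor_square_operator(2)[OF A] x(2) y(2)
      by (simp add: tensor_scale_left tensor_scale_right scaleC_scaleC mult.commute)
    with tensor_nonzero[OF x(1) y(1)] show ?thesis
      unfolding point_spectrum_def by blast
  qed
  ultimately show ?thesis by blast
qed

end

theorem theorem1:
  fixes M :: "'a measure"
    and rep :: "'x::complex_banach \<Rightarrow> 'a \<Rightarrow> complex"
    and A :: "'x \<Rightarrow> 'x"
    and \<iota> :: "('a \<times> 'a \<Rightarrow> complex) \<Rightarrow> 'c::complex_banach"
  assumes "banach_ideal_space M rep"
    and "almost_perfect M rep"
    and "compact_operator A"
    and "nonneg_operator M rep A"
    and "resolvent_regular M rep A"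
    and "levin_completion M rep \<iota>"
  shows "point_spectrum (tensor_square_operator rep \<iota> A) - {0} =
    {\<alpha> * \<beta> | \<alpha> \<beta>. \<alpha> \<in> point_spectrum A \<and> \<beta> \<in> point_spectrum A} - {0}"
proof -
  interpret levin_square M rep \<iota>
    using assms(1,6) by (simp add: levin_square_def levin_square_axioms_def)
  show ?thesis
    by (rule point_spectrum_tensor_square[OF assms(3,4)])
qed

end
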